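(* Let $A$ be a finite set. Then every non-wandering subshift of finite type $\Sigma\subset A^{\mathbb{Z}}$ is surjunctive (every injective endomorphism of $(\Sigma,\sigma)$ is surjective) and has the Moore property (every surjective endomorphism of $(\Sigma,\sigma)$ is pre-injective).
   Context: $A$ is given the discrete topology and $A^{\mathbb{Z}}$ the product topology; it is compact and metrizable. The shift $\sigma\colon A^{\mathbb{Z}}\to A^{\mathbb{Z}}$ is the homeomorphism given by $(\sigma(u))_n=u_{n-1}$. A subshift is a closed subset $\Sigma\subset A^{\mathbb{Z}}$ with $\sigma(\Sigma)=\Sigma$, viewed as a dynamical system $(\Sigma,\sigma)$. A subshift $\Sigma$ is of finite type if there exist an integer $m\ge 0$ and a set $F$ of words of length $m+1$ over $A$ such that $\Sigma$ is the set of all $u=(u_n)_{n\in\mathbb{Z}}\in A^{\mathbb{Z}}$ with $u_nu_{n+1}\cdots u_{n+m}\in F$ for all $n\in\mathbb{Z}$. $(\Sigma,\sigma)$ is non-wandering if for every $x\in\Sigma$ and every neighborhood $U$ of $x$ in $\Sigma$ there is an integer $n\ge 1$ with $U\cap\sigma^n(U)\neq\varnothing$. An endomorphism of $(\Sigma,\sigma)$ is a continuous map $\tau\colon\Sigma\to\Sigma$ with $\tau\circ\sigma=\sigma\circ\tau$. Given a compatible metric $d$ on $\Sigma$, two points $x,y\in\Sigma$ are homoclinic if $d(\sigma^n(x),\sigma^n(y))\to 0$ as $|n|\to\infty$ (this does not depend on $d$). An endomorphism is pre-injective if its restriction to every homoclinicity class of $\Sigma$ is injective. *)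

theory Defs
  imports "HOL-Analysis.Analysis"
begin

definition full_shift :: "'a set \<Rightarrow> (int \<Rightarrow> 'a) topology" where
  "full_shift A = product_topology (\<lambda>_. discrete_topology A) UNIV"

definition shift :: "(int \<Rightarrow> 'a) \<Rightarrow> int \<Rightarrow> 'a" where
  "shift u = (\<lambda>n. u (n - 1))"

text \<open>Powers with integer exponent; \<^term>\<open>shift\<close> is a bijection of the whole type
  \<^typ>\<open>int \<Rightarrow> 'a\<close>, so the global inverse agrees with the inverse on each subshift.\<close>

definition shift_pow :: "int \<Rightarrow> (int \<Rightarrow> 'a) \<Rightarrow> int \<Rightarrow> 'a" where
  "shift_pow n = (if n \<ge> 0 then shift ^^ nat n else inv shift ^^ nat (- n))"

definition subshift :: "'a set \<Rightarrow> (int \<Rightarrow> 'a) set \<Rightarrow> bool" where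
  "subshift A \<Sigma> \<longleftrightarrow> closedin (full_shift A) \<Sigma> \<and> shift ` \<Sigma> = \<Sigma>"

abbreviation subshift_topology :: "'a set \<Rightarrow> (int \<Rightarrow> 'a) set \<Rightarrow> (int \<Rightarrow> 'a) topology" where
  "subshift_topology A \<Sigma> \<equiv> subtopology (full_shift A) \<Sigma>"

definition subshift_of_finite_type :: "'a set \<Rightarrow> (int \<Rightarrow> 'a) set \<Rightarrow> bool" where
  "subshift_of_finite_type A \<Sigma> \<longleftrightarrow> subshift A \<Sigma> \<and>
     (\<exists>(m::nat) F. F \<subseteq> {w. length w = m + 1 \<and> set w \<subseteq> A} \<and>
        \<Sigma> = {u \<in> topspace (full_shift A). \<forall>n. map (\<lambda>i. u (n + int i)) [0..<m + 1] \<in> F})"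

text \<open>Neighborhoods are not required to be open.\<close>

definition non_wandering :: "'a set \<Rightarrow> (int \<Rightarrow> 'a) set \<Rightarrow> bool" where
  "non_wandering A \<Sigma> \<longleftrightarrow>
     (\<forall>x\<in>\<Sigma>. \<forall>U\<subseteq>\<Sigma>. (\<exists>V. openin (subshift_topology A \<Sigma>) V \<and> x \<in> V \<and> V \<subseteq> U) \<longrightarrow>
        (\<exists>n::nat. n \<ge> 1 \<and> U \<inter> (shift ^^ n) ` U \<noteq> {}))"

text \<open>Maps between subshifts are functions on the whole type; only their values on
  \<open>\<Sigma>\<close> matter.\<close>

definition endomorphism :: "'a set \<Rightarrow> (int \<Rightarrow> 'a) set \<Rightarrow> ((int \<Rightarrow> 'a) \<Rightarrow> int \<Rightarrow> 'a) \<Rightarrow> bool" where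
  "endomorphism A \<Sigma> \<tau> \<longleftrightarrow>
     continuous_map (subshift_topology A \<Sigma>) (subshift_topology A \<Sigma>) \<tau> \<and>
     (\<forall>u\<in>\<Sigma>. \<tau> (shift u) = shift (\<tau> u))"

definition compatible_metric ::
    "'a set \<Rightarrow> (int \<Rightarrow> 'a) set \<Rightarrow> ((int \<Rightarrow> 'a) \<Rightarrow> (int \<Rightarrow> 'a) \<Rightarrow> real) \<Rightarrow> bool" where
  "compatible_metric A \<Sigma> d \<longleftrightarrow>
     Metric_space \<Sigma> d \<and> Metric_space.mtopology \<Sigma> d = subshift_topology A \<Sigma>"

text \<open>For finite \<open>A\<close> a subshift is compact and metrizable, so a compatible metric exists
  and the convergence does not depend on its choice; quantifying existentially or universally
  over \<open>d\<close> therefore gives the same relation.  The filter is \<open>\<bar>n\<bar> \<rightarrow> \<infinity>\<close>.\<close>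

definition homoclinic ::
    "'a set \<Rightarrow> (int \<Rightarrow> 'a) set \<Rightarrow> (int \<Rightarrow> 'a) \<Rightarrow> (int \<Rightarrow> 'a) \<Rightarrow> bool" where
  "homoclinic A \<Sigma> x y \<longleftrightarrow> x \<in> \<Sigma> \<and> y \<in> \<Sigma> \<and>
     (\<exists>d. compatible_metric A \<Sigma> d \<and>
        ((\<lambda>n::int. d (shift_pow n x) (shift_pow n y)) \<longlongrightarrow> 0) (filtercomap abs at_top))"

definition pre_injective :: "'a set \<Rightarrow> (int \<Rightarrow> 'a) set \<Rightarrow> ((int \<Rightarrow> 'a) \<Rightarrow> int \<Rightarrow> 'a) \<Rightarrow> bool" where
  "pre_injective A \<Sigma> \<tau> \<longleftrightarrow> (\<forall>x\<in>\<Sigma>. inj_on \<tau> {y. homoclinic A \<Sigma> x y})"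

definition surjunctive :: "'a set \<Rightarrow> (int \<Rightarrow> 'a) set \<Rightarrow> bool" where
  "surjunctive A \<Sigma> \<longleftrightarrow> (\<forall>\<tau>. endomorphism A \<Sigma> \<tau> \<and> inj_on \<tau> \<Sigma> \<longrightarrow> \<tau> ` \<Sigma> = \<Sigma>)"

definition Moore_property :: "'a set \<Rightarrow> (int \<Rightarrow> 'a) set \<Rightarrow> bool" where
  "Moore_property A \<Sigma> \<longleftrightarrow>
     (\<forall>\<tau>. endomorphism A \<Sigma> \<tau> \<and> \<tau> ` \<Sigma> = \<Sigma> \<longrightarrow> pre_injective A \<Sigma> \<tau>)"

end

theory Submission
  imports Defs
begin

text \<open>Non-wandering and finite type together make periodic points dense. An injective endomorphism
  permutes the finitely many points of each period, so its image is dense; being compact, it is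
  everything.

  For the Moore property, call two points linked if some orbit of the subshift leads from the state
  (central block of length \<open>m\<close>) of one to that of the other. By recurrence this is an equivalence
  relation with finitely many classes, which a surjective endomorphism permutes; hence some power
  \<open>T\<close> maps the class \<open>C\<close> of a given \<open>x\<close> onto itself. If \<open>x \<noteq> y\<close> differ in finitely many places and
  \<open>T x = T y\<close>, then long central blocks \<open>u\<close> of \<open>x\<close> and \<open>v\<close> of \<open>y\<close> are interchangeable without
  changing images, so, if \<open>v\<close> precedes \<open>u\<close> lexicographically, every block of \<open>C\<close> has a preimage
  block avoiding \<open>u\<close>. Thus \<open>C\<close> has at most a constant factor more blocks of length \<open>n\<close> than blocks
  avoiding \<open>u\<close>. But inserting a loop of fixed length through \<open>u\<close> at any of \<open>q\<close> places
  of a block avoiding \<open>u\<close> yields different blocks, so that this factor would be at least of order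
  \<open>q\<close>, for every \<open>q\<close>.\<close>

section \<open>Translates, blocks and periodic points\<close>

text \<open>Moves coordinate \<open>k\<close> to the origin, so that one family covers all integer
  powers of \<open>shift\<close>, the inverse ones included.\<close>

definition translate :: "int \<Rightarrow> (int \<Rightarrow> 'a) \<Rightarrow> int \<Rightarrow> 'a" where
  "translate k z = (\<lambda>i. z (i + k))"

definition block :: "(int \<Rightarrow> 'a) \<Rightarrow> int \<Rightarrow> nat \<Rightarrow> 'a list" where
  "block z k n = map (\<lambda>i. z (k + int i)) [0..<n]"

definition periodic :: "nat \<Rightarrow> (int \<Rightarrow> 'a) \<Rightarrow> bool" where
  "periodic n z \<longleftrightarrow> n \<ge> 1 \<and> (\<forall>i. z (i + int n) = z i)"

lemma translate_apply [simp]: "translate k z i = z (i + k)"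
  by (simp add: translate_def)

lemma translate_translate [simp]: "translate k (translate l z) = translate (k + l) z"
  by (simp add: translate_def fun_eq_iff add.assoc)

lemma translate_0 [simp]: "translate 0 z = z"
  by (simp add: translate_def)

lemma shift_eq_translate: "shift = translate (-1)"
  by (simp add: shift_def translate_def fun_eq_iff)

lemma shift_funpow: "(shift ^^ n) z = translate (- int n) z"
  by (induction n) (simp_all add: shift_eq_translate del: translate_apply)

lemma inv_shift: "inv shift = translate 1"
  by (rule inv_unique_comp) (simp_all add: fun_eq_iff shift_eq_translate)

lemma inv_shift_funpow: "(inv shift ^^ n) z = translate (int n) z"
  by (induction n) (simp_all add: inv_shift add.commute del: translate_apply)

lemma shift_pow_eq_translate: "shift_pow n z = translate (- n) z"
  by (simp add: shift_pow_def shift_funpow inv_shift_funpow)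

lemma length_block [simp]: "length (block z k n) = n"
  by (simp add: block_def)

lemma nth_block [simp]: "i < n \<Longrightarrow> block z k n ! i = z (k + int i)"
  by (simp add: block_def)

lemma block_eq_iff: "block z k n = block w l n \<longleftrightarrow> (\<forall>i. 0 \<le> i \<and> i < int n \<longrightarrow> z (k + i) = w (l + i))"
proof -
  have "block z k n = block w l n \<longleftrightarrow> (\<forall>i<n. z (k + int i) = w (l + int i))"
    by (simp add: list_eq_iff_nth_eq)
  also have "\<dots> \<longleftrightarrow> (\<forall>i. 0 \<le> i \<and> i < int n \<longrightarrow> z (k + i) = w (l + i))"
    by (metis nat_int of_nat_0_le_iff of_nat_less_iff zero_le_imp_eq_int)
  finally show ?thesis .
qed

lemma block_eq_iff_range:
  "block z k n = block w l n \<longleftrightarrow> (\<forall>i. k \<le> i \<and> i < k + int n \<longrightarrow> z i = w (i + (l - k)))"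
proof -
  have "(\<forall>i. 0 \<le> i \<and> i < int n \<longrightarrow> z (k + i) = w (l + i)) \<longleftrightarrow>
    (\<forall>i. k \<le> i \<and> i < k + int n \<longrightarrow> z i = w (i + (l - k)))" (is "?l = ?r")
  proof
    assume l: ?l
    show ?r
    proof (intro allI impI)
      fix i assume "k \<le> i \<and> i < k + int n"
      then show "z i = w (i + (l - k))"
        using l[rule_format, of "i - k"] by (simp add: algebra_simps)
    qed
  next
    assume r: ?r
    show ?l
    proof (intro allI impI)
      fix i assume "0 \<le> i \<and> i < int n"
      then show "z (k + i) = w (l + i)"
        using r[rule_format, of "k + i"] by (simp add: algebra_simps)
    qed
  qed
  then show ?thesis by (simp add: block_eq_iff)
qed

lemma block_add: "block z k (a + b) = block z k a @ block z (k + int a) b"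
  by (rule nth_equalityI) (auto simp: nth_append)

lemma block_translate: "block (translate l z) k n = block z (k + l) n"
  by (simp add: block_eq_iff algebra_simps)

lemma set_block_subset: "(\<And>i. z i \<in> A) \<Longrightarrow> set (block z k n) \<subseteq> A"
  by (auto simp: block_def)

lemma periodic_mult:
  assumes "periodic n z"
  shows "z (i + k * int n) = z i"
proof -
  have up: "z (j + int c * int n) = z j" for j c
  proof (induction c)
    case (Suc c)
    have "z (j + int (Suc c) * int n) = z ((j + int c * int n) + int n)"
      by (simp add: algebra_simps)
    then show ?case using Suc assms by (simp add: periodic_def)
  qed simp
  show ?thesis
  proof (cases "k \<ge> 0")
    case True
    then show ?thesis using up[of i "nat k"] by simp
  next
    case False
    then show ?thesis using up[of "i + k * int n" "nat (- k)"] by simp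
  qed
qed

lemma periodic_mod: "periodic n z \<Longrightarrow> z i = z (i mod int n)"
  using periodic_mult[of n z "i mod int n" "i div int n"]
  by (simp add: algebra_simps)

lemma periodic_dvd:
  assumes "periodic n p" "n dvd k" "k \<ge> 1"
  shows "periodic k p"
proof -
  obtain c where "k = n * c" using \<open>n dvd k\<close> by (rule dvdE)
  then have "int k = int c * int n" by simp
  then have "p (i + int k) = p i" for i
    using periodic_mult[OF assms(1)] by (simp only:)
  then show ?thesis
    using \<open>k \<ge> 1\<close> by (simp add: periodic_def)
qed

text \<open>The two blocks of length \<open>n\<close> share everything outside the window of length
  \<open>l\<close> at \<open>a\<close>. Common prefixes and suffixes do not affect the comparison,
  so the windows decide it.\<close>

lemma lex_block_replace:
  fixes z z' :: "int \<Rightarrow> 'a"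
  assumes "(block y b l, block x c l) \<in> lex R" "block z a l = block x c l" "block z' a l = block y b l"
    "a \<ge> 0" "a + int l \<le> int n" "\<And>i. i < a \<Longrightarrow> z' i = z i" "\<And>i. i \<ge> a + int l \<Longrightarrow> z' i = z i"
  shows "(block z' 0 n, block z 0 n) \<in> lex R"
proof -
  obtain k where k: "a = int k" using \<open>a \<ge> 0\<close> zero_le_imp_eq_int by blast
  define j where "j = n - k - l"
  have n: "n = k + (l + j)" using assms(5) k by (simp add: j_def)
  have split: "block w 0 n = block w 0 k @ block w a l @ block w (a + int l) j" for w :: "int \<Rightarrow> 'a"
    by (simp add: n block_add k)
  have eq: "block z' 0 k = block z 0 k" "block z' (a + int l) j = block z (a + int l) j"
    using assms(6,7) k by (simp_all add: block_eq_iff)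
  have "(block y b l @ block z (a + int l) j, block x c l @ block z (a + int l) j) \<in> lex R"
    using assms(1) by (rule lex_append_rightI) simp
  then show ?thesis
    unfolding split eq assms(2,3) by (rule lex_append_leftI)
qed

text \<open>The letters carry no order, so one is taken from a well-order of the type with the
  diagonal removed. Well-foundedness will give least preimages, totality will make the two sides of
  a diamond comparable.\<close>

lemma wf_total_rel_exists: "\<exists>r :: 'a rel. wf r \<and> total r"
proof -
  obtain r :: "'a rel" where "well_order_on UNIV r"
    using well_order_on ..
  then have "wf (r - Id)" "total_on UNIV r"
    unfolding well_order_on_def linear_order_on_def by (rule conjunct2, elim conjE)
  then have "wf (r - Id) \<and> total (r - Id)"
    by (simp only: total_on_diff_Id)
  then show ?thesis ..
qed

section \<open>Linked points of a recurrent shift of finite type\<close>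

text \<open>\<open>splice\<close> is what finite type is used for, \<open>approx\<close> is what non-wandering is used for.\<close>

locale recurrent_sft =
  fixes A :: "'a set" and \<Sigma> :: "(int \<Rightarrow> 'a) set" and m :: nat
  assumes finite_A: "finite A"
    and in_A: "z \<in> \<Sigma> \<Longrightarrow> z i \<in> A"
    and translate_in: "z \<in> \<Sigma> \<Longrightarrow> translate k z \<in> \<Sigma>"
    and splice: "\<lbrakk>z \<in> \<Sigma>; w \<in> \<Sigma>; \<And>i. a \<le> i \<Longrightarrow> i < a + int m \<Longrightarrow> z i = w i\<rbrakk>
      \<Longrightarrow> (\<lambda>i. if i < a then z i else w i) \<in> \<Sigma>"
    and approx: "z \<in> \<Sigma> \<Longrightarrow> \<exists>n p. p \<in> \<Sigma> \<and> periodic n p \<and> (\<forall>i. \<bar>i\<bar> \<le> int N \<longrightarrow> p i = z i)"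
begin

definition link :: "(int \<Rightarrow> 'a) \<Rightarrow> (int \<Rightarrow> 'a) \<Rightarrow> bool" where
  "link z w \<longleftrightarrow> (\<exists>g\<in>\<Sigma>. \<exists>a\<ge>0. block g 0 m = block z 0 m \<and> block g a m = block w 0 m)"

text \<open>Splicing after \<open>w\<close> has been moved so that its block at \<open>b\<close>
  lies over the block of \<open>z\<close> at \<open>a\<close>. On the overlap of length
  \<open>m\<close> both descriptions of \<open>g\<close> hold, which is why their ranges
  intersect.\<close>

lemma splice_block:
  assumes "z \<in> \<Sigma>" "w \<in> \<Sigma>" "block z a m = block w b m"
  obtains g where "g \<in> \<Sigma>" "\<And>i. i < a + int m \<Longrightarrow> g i = z i" "\<And>i. a \<le> i \<Longrightarrow> g i = w (i + (b - a))"
proof -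
  let ?w = "translate (b - a) w"
  have eq: "z i = ?w i" if "a \<le> i" "i < a + int m" for i
    using assms(3) that by (simp add: block_eq_iff_range)
  show ?thesis
  proof
    show "(\<lambda>i. if i < a then z i else ?w i) \<in> \<Sigma>"
      using assms(1) translate_in[OF assms(2)] eq by (rule splice)
  qed (use eq in auto)
qed

lemma link_refl: "z \<in> \<Sigma> \<Longrightarrow> link z z"
  by (force simp: link_def)

lemma link_cong: "block z 0 m = block z' 0 m \<Longrightarrow> block w 0 m = block w' 0 m \<Longrightarrow> link z w = link z' w'"
  by (simp add: link_def)

text \<open>Follow \<open>g\<close> up to the state of \<open>y\<close>, then continue along
  \<open>h\<close>.\<close>

lemma link_trans:
  assumes "link x y" "link y z"
  shows "link x z"
proof -
  obtain g a where g: "g \<in> \<Sigma>" "a \<ge> 0" "block g 0 m = block x 0 m" "block g a m = block y 0 m"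
    using assms(1) by (auto simp: link_def)
  obtain h b where h: "h \<in> \<Sigma>" "b \<ge> 0" "block h 0 m = block y 0 m" "block h b m = block z 0 m"
    using assms(2) by (auto simp: link_def)
  obtain f where f: "f \<in> \<Sigma>" "\<And>i. i < a + int m \<Longrightarrow> f i = g i" "\<And>i. a \<le> i \<Longrightarrow> f i = h (i + (0 - a))"
    using splice_block[OF g(1) h(1), of a 0] g h by metis
  have "block f 0 m = block g 0 m"
    using f(2) g(2) by (simp add: block_eq_iff)
  moreover have "block f (a + b) m = block h b m"
    using f(3) h(2) by (simp add: block_eq_iff)
  ultimately show ?thesis
    unfolding link_def using f(1) g h by (intro bexI[of _ f] exI[of _ "a + b"]) auto
qed

lemma periodic_approx:
  assumes "z \<in> \<Sigma>"
  obtains n p where "p \<in> \<Sigma>" "periodic n p" "\<And>i. \<bar>i\<bar> \<le> N \<Longrightarrow> p i = z i"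
proof -
  obtain n p where "p \<in> \<Sigma>" "periodic n p" "\<forall>i. \<bar>i\<bar> \<le> int (nat N) \<longrightarrow> p i = z i"
    using approx[OF assms] by blast
  then show ?thesis
    by (intro that[of p n]) (auto split: if_splits)
qed

text \<open>A periodic point that follows \<open>g\<close> from the state of \<open>x\<close> to the
  state of \<open>y\<close> must come back to the state of \<open>x\<close>.\<close>

lemma link_sym:
  assumes "link x y"
  shows "link y x"
proof -
  obtain g a where g: "g \<in> \<Sigma>" "a \<ge> 0" "block g 0 m = block x 0 m" "block g a m = block y 0 m"
    using assms(1) by (auto simp: link_def)
  obtain n p where p: "p \<in> \<Sigma>" "periodic n p" "\<And>i. \<bar>i\<bar> \<le> a + int m \<Longrightarrow> p i = g i"
    using periodic_approx[OF g(1)] by blast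
  have n: "int n \<ge> 1" using p by (simp add: periodic_def)
  show ?thesis unfolding link_def
  proof (intro bexI exI conjI)
    show "translate a p \<in> \<Sigma>" using p translate_in by blast
    \<comment> \<open>Position \<open>a * int n\<close> is a multiple of the period not before
      \<open>a\<close>. The state of \<open>x\<close> is seen there again,
      \<open>a * int n - a\<close> steps after that of \<open>y\<close>.\<close>
    have "a * 1 \<le> a * int n" using n g(2) by (intro mult_left_mono) auto
    then show "0 \<le> a * int n - a" by simp
    have "block (translate a p) 0 m = block g a m"
      using p(3) g(2) by (auto simp: block_eq_iff add.commute)
    then show "block (translate a p) 0 m = block y 0 m" using g by simp
    have "block (translate a p) (a * int n - a) m = block p (0 + a * int n) m"
      by (simp add: block_translate)
    also have "\<dots> = block p 0 m"
      using periodic_mult[OF p(2), of _ a] by (simp add: block_eq_iff add.commute)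
    also have "\<dots> = block g 0 m"
      using p(3) g(2) by (simp add: block_eq_iff)
    finally show "block (translate a p) (a * int n - a) m = block x 0 m" using g by simp
  qed
qed

lemma link_translate:
  assumes "z \<in> \<Sigma>"
  shows "link z (translate k z)"
proof -
  have pos: "link z (translate k z)" if "z \<in> \<Sigma>" "k \<ge> 0" for z k
    unfolding link_def using that
    by (intro bexI[of _ z] exI[of _ k]) (auto simp: block_translate)
  show ?thesis
  proof (cases "k \<ge> 0")
    case True
    then show ?thesis using pos assms by blast
  next
    case False
    then have "link (translate k z) (translate (- k) (translate k z))"
      using assms by (intro pos translate_in) auto
    then show ?thesis by (simp add: link_sym)
  qed
qed

text \<open>By invariance under translation, one common state at any two positions suffices. In
  practice it is found in a tail shared by the two points.\<close>

lemma link_blockI: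
  assumes "z \<in> \<Sigma>" "w \<in> \<Sigma>" "block z k m = block w l m"
  shows "link z w"
proof -
  have "link (translate k z) (translate l w)"
    using link_refl[OF translate_in[OF assms(1)], of k] assms(3)
      link_cong[of "translate k z" "translate k z" "translate k z" "translate l w"]
    by (simp add: block_translate)
  then show ?thesis
    using link_translate[OF assms(1)] link_translate[OF assms(2)] link_trans link_sym by blast
qed

lemma finite_blocks: "finite {block z k n | z k. z \<in> \<Sigma>}"
proof (rule finite_subset)
  show "{block z k n | z k. z \<in> \<Sigma>} \<subseteq> {xs. set xs \<subseteq> A \<and> length xs = n}"
    using set_block_subset[OF in_A] by fastforce
qed (rule finite_lists_length_eq[OF finite_A])

definition link_class :: "(int \<Rightarrow> 'a) \<Rightarrow> (int \<Rightarrow> 'a) set" where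
  "link_class z = {w \<in> \<Sigma>. link z w}"

lemma link_class_eq_iff: "z \<in> \<Sigma> \<Longrightarrow> w \<in> \<Sigma> \<Longrightarrow> link_class z = link_class w \<longleftrightarrow> link z w"
proof
  assume "z \<in> \<Sigma>" "w \<in> \<Sigma>" "link_class z = link_class w"
  then show "link z w"
    using link_refl[of w] by (auto simp: link_class_def)
next
  assume "link z w"
  then show "link_class z = link_class w"
    unfolding link_class_def using link_trans[of z w] link_trans[of w z] link_sym[of z w] by blast
qed

text \<open>A class is determined by the state at the origin of any of its points, and there are
  finitely many states.\<close>

lemma finite_link_classes: "finite (link_class ` \<Sigma>)"
proof (rule finite_surj)
  let ?B = "{block z k m | z k. z \<in> \<Sigma>}"
  let ?f = "\<lambda>b. link_class (SOME z. z \<in> \<Sigma> \<and> block z 0 m = b)"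
  show "finite ?B" by (rule finite_blocks)
  show "link_class ` \<Sigma> \<subseteq> ?f ` ?B"
  proof
    fix X assume "X \<in> link_class ` \<Sigma>"
    then obtain z where z: "z \<in> \<Sigma>" "X = link_class z" by blast
    let ?w = "SOME w. w \<in> \<Sigma> \<and> block w 0 m = block z 0 m"
    have w: "?w \<in> \<Sigma> \<and> block ?w 0 m = block z 0 m"
      by (rule someI[of _ z]) (simp add: z)
    then have "X = ?f (block z 0 m)"
      using z link_blockI link_class_eq_iff by metis
    then show "X \<in> ?f ` ?B" using z by blast
  qed
qed

section \<open>Sliding block maps\<close>

text \<open>The combinatorial content of an endomorphism: a local rule of radius \<open>r\<close>,
  as in the Curtis-Hedlund-Lyndon theorem. The counting below then needs no topology.\<close>

definition block_map :: "nat \<Rightarrow> ((int \<Rightarrow> 'a) \<Rightarrow> int \<Rightarrow> 'a) \<Rightarrow> bool" where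
  "block_map r T \<longleftrightarrow> (\<forall>z\<in>\<Sigma>. T z \<in> \<Sigma>) \<and> (\<forall>z\<in>\<Sigma>. \<forall>k. T (translate k z) = translate k (T z)) \<and>
     (\<forall>z\<in>\<Sigma>. \<forall>w\<in>\<Sigma>. (\<forall>i. \<bar>i\<bar> \<le> int r \<longrightarrow> z i = w i) \<longrightarrow> T z 0 = T w 0)"

lemma block_map_in: "block_map r T \<Longrightarrow> z \<in> \<Sigma> \<Longrightarrow> T z \<in> \<Sigma>"
  unfolding block_map_def by blast

lemma block_map_local:
  assumes T: "block_map r T" and z: "z \<in> \<Sigma>" and w: "w \<in> \<Sigma>"
    and eq: "\<And>i. \<bar>i - j\<bar> \<le> int r \<Longrightarrow> z i = w (i + d)"
  shows "T z j = T w (j + d)"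
proof -
  have com: "T (translate k v) = translate k (T v)" if "v \<in> \<Sigma>" for v k
    using T that unfolding block_map_def by blast
  have "translate j z i = translate (j + d) w i" if "\<bar>i\<bar> \<le> int r" for i
    using eq[of "i + j"] that by (simp add: add.assoc)
  then have "T (translate j z) 0 = T (translate (j + d) w) 0"
    using T translate_in[OF z] translate_in[OF w] unfolding block_map_def by blast
  then show ?thesis
    using com[OF z] com[OF w] by simp
qed

text \<open>Two splices give a point \<open>f\<close> with the left tail of \<open>z\<close> and, up
  to translation, the right tail of \<open>w\<close>. By locality \<open>T f\<close> shares a left
  tail with \<open>T z\<close> and a right tail with \<open>T w\<close>, hence a state with
  each.\<close>

lemma link_block_map:
  assumes T: "block_map r T" and z: "z \<in> \<Sigma>" and w: "w \<in> \<Sigma>" and "link z w"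
  shows "link (T z) (T w)"
proof -
  obtain g a where g: "g \<in> \<Sigma>" "a \<ge> 0" "block g 0 m = block z 0 m" "block g a m = block w 0 m"
    using \<open>link z w\<close> by (auto simp: link_def)
  obtain h where h: "h \<in> \<Sigma>" "\<And>i. i < 0 + int m \<Longrightarrow> h i = z i" "\<And>i. 0 \<le> i \<Longrightarrow> h i = g (i + (0 - 0))"
    using splice_block[OF z g(1), of 0 0] g(3) by metis
  have "block h a m = block w 0 m"
    using h(3) g(2) unfolding g(4)[symmetric] by (simp add: block_eq_iff)
  then obtain f where f: "f \<in> \<Sigma>" "\<And>i. i < a + int m \<Longrightarrow> f i = h i" "\<And>i. a \<le> i \<Longrightarrow> f i = w (i + (0 - a))"
    using splice_block[OF h(1) w, of a 0] by metis
  have Tf: "T f \<in> \<Sigma>" "T z \<in> \<Sigma>" "T w \<in> \<Sigma>"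
    using block_map_in[OF T] f(1) z w by blast+
  have "T z j = T f j" if "j < - int r" for j
    using block_map_local[OF T z f(1), of j 0] f(2) h(2) g(2) that by auto
  \<comment> \<open>The last \<open>m\<close> coordinates before \<open>- int r\<close>: their
    values under \<open>T\<close> depend only on negative coordinates, where \<open>f\<close> and
    \<open>z\<close> agree.\<close>
  then have "block (T z) (- int r - int m) m = block (T f) (- int r - int m) m"
    by (simp add: block_eq_iff)
  then have 1: "link (T z) (T f)"
    using link_blockI Tf by blast
  have "T f j = T w (j + - a)" if "j \<ge> a + int r" for j
    using f(3) that by (intro block_map_local[OF T f(1) w]) auto
  then have "block (T f) (a + int r) m = block (T w) (int r) m"
    by (simp add: block_eq_iff)
  then have "link (T f) (T w)"
    using link_blockI Tf by blast
  with 1 show ?thesis by (rule link_trans)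
qed

text \<open>A surjection acts surjectively, hence by a permutation, on the finitely many classes.\<close>

lemma link_block_map_cancel:
  assumes T: "block_map r T" and surj: "T ` \<Sigma> = \<Sigma>"
    and z: "z \<in> \<Sigma>" and w: "w \<in> \<Sigma>" and "link (T z) (T w)"
  shows "link z w"
proof -
  let ?Q = "link_class ` \<Sigma>"
  have T_in: "T v \<in> \<Sigma>" if "v \<in> \<Sigma>" for v
    using block_map_in[OF T that] .
  \<comment> \<open>The map that \<open>T\<close> induces on classes, through chosen
    representatives; \<open>link_block_map\<close> makes the choice immaterial.\<close>
  define F where "F X = link_class (T (SOME z. z \<in> X))" for X
  have F: "F (link_class z) = link_class (T z)" if "z \<in> \<Sigma>" for z
  proof -
    have "z \<in> link_class z"
      using that link_refl by (simp add: link_class_def)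
    then have "(SOME v. v \<in> link_class z) \<in> link_class z"
      by (rule someI[where P = "\<lambda>v. v \<in> link_class z"])
    then have v: "(SOME v. v \<in> link_class z) \<in> \<Sigma>" "link z (SOME v. v \<in> link_class z)"
      unfolding link_class_def by blast+
    then have "link (T z) (T (SOME v. v \<in> link_class z))"
      using link_block_map[OF T that] by blast
    then show ?thesis
      unfolding F_def using v(1) that T_in link_class_eq_iff by metis
  qed
  have "F ` ?Q = link_class ` (T ` \<Sigma>)"
    using F by (simp add: image_image)
  then have "inj_on F ?Q"
    using finite_link_classes surj by (intro eq_card_imp_inj_on) auto
  moreover have "F (link_class z) = F (link_class w)"
    using F z w \<open>link (T z) (T w)\<close> T_in link_class_eq_iff by metis
  ultimately have "link_class z = link_class w"
    using z w by (auto dest: inj_onD)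
  then show ?thesis
    using link_class_eq_iff z w by blast
qed

lemma link_funpow_cancel:
  assumes T: "block_map r T" and surj: "T ` \<Sigma> = \<Sigma>"
  shows "z \<in> \<Sigma> \<Longrightarrow> w \<in> \<Sigma> \<Longrightarrow> link ((T ^^ p) z) ((T ^^ p) w) \<Longrightarrow> link z w"
proof (induction p arbitrary: z w)
  case (Suc p)
  have "link (T z) (T w)"
    using Suc.IH[of "T z" "T w"] Suc.prems surj by (auto simp: funpow_swap1)
  then show ?case
    using link_block_map_cancel[OF T surj] Suc.prems by blast
qed simp

text \<open>By the pigeonhole principle two iterates of \<open>x\<close> lie in the same class.
  Cancelling the smaller exponent leaves a return to the class of \<open>x\<close> itself.\<close>

lemma link_funpow_recurrent:
  assumes T: "block_map r T" and surj: "T ` \<Sigma> = \<Sigma>" and x: "x \<in> \<Sigma>"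
  shows "\<exists>p\<ge>1. link ((T ^^ p) x) x"
proof -
  have pow: "(T ^^ p) z \<in> \<Sigma>" if "z \<in> \<Sigma>" for p z
    using that surj by (induction p) auto
  have "range (\<lambda>i. link_class ((T ^^ i) x)) \<subseteq> link_class ` \<Sigma>"
    using pow[OF x] by auto
  then have "finite (range (\<lambda>i. link_class ((T ^^ i) x)))"
    using finite_link_classes finite_subset by blast
  then have "\<not> inj (\<lambda>i. link_class ((T ^^ i) x))"
    using finite_imageD by blast
  then obtain i j where ij: "i < j" "link_class ((T ^^ i) x) = link_class ((T ^^ j) x)"
    unfolding inj_on_def by (metis nat_neq_iff)
  then have "link ((T ^^ j) x) ((T ^^ i) x)"
    using link_class_eq_iff pow[OF x] by metis
  moreover have "(T ^^ j) x = (T ^^ i) ((T ^^ (j - i)) x)"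
    using ij(1) by (simp flip: funpow_add[THEN fun_cong, unfolded o_def])
  ultimately have "link ((T ^^ (j - i)) x) x"
    using link_funpow_cancel[OF T surj pow[OF x] x] by metis
  then show ?thesis
    using ij(1) by (intro exI[of _ "j - i"]) auto
qed

section \<open>Loops through a given block\<close>

lemma periodic_through:
  assumes z: "z \<in> \<Sigma>" and x: "x \<in> \<Sigma>" and "link z x"
  obtains n p a where "p \<in> \<Sigma>" "periodic n p" "block p 0 m = block z 0 m"
    "a \<ge> 0" "a + int l \<le> int n" "block p a l = block x c l"
proof -
  have "link z (translate c x)"
    using assms link_translate link_trans by blast
  then obtain g a where g: "g \<in> \<Sigma>" "a \<ge> 0" "block g 0 m = block z 0 m" "block g a m = block (translate c x) 0 m"
    by (auto simp: link_def)
  then have "block g a m = block x c m"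
    by (simp add: block_translate)
  then obtain f where f: "f \<in> \<Sigma>" "\<And>i. i < a + int m \<Longrightarrow> f i = g i" "\<And>i. a \<le> i \<Longrightarrow> f i = x (i + (c - a))"
    using splice_block[OF g(1) x, of a c] by metis
  \<comment> \<open>The radius covers both the initial state and the occurrence of the block of
    \<open>x\<close> at \<open>a\<close>.\<close>
  obtain n p where p: "p \<in> \<Sigma>" "periodic n p" "\<And>i. \<bar>i\<bar> \<le> a + int m + int l \<Longrightarrow> p i = f i"
    using periodic_approx[OF f(1)] by blast
  \<comment> \<open>The period \<open>n\<close> may be shorter than \<open>a + l\<close>, so
    \<open>k\<close> periods are taken as one. The summand 1 keeps the new period positive when
    \<open>a\<close> and \<open>l\<close> vanish.\<close>
  define k where "k = nat a + l + 1"
  have n: "n \<ge> 1" using p by (simp add: periodic_def)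
  show ?thesis
  proof
    show "p \<in> \<Sigma>" by fact
    have "p (i + int (k * n)) = p i" for i
      using periodic_mult[OF p(2), of i "int k"] by simp
    then show "periodic (k * n) p"
      using n by (simp add: periodic_def k_def)
    show "block p 0 m = block z 0 m"
      using p(3) f(2) g(2) unfolding g(3)[symmetric] by (simp add: block_eq_iff)
    show "a \<ge> 0" by fact
    have "k * 1 \<le> k * n" using n by (intro mult_left_mono) auto
    then have "int k \<le> int (k * n)" by (simp only: of_nat_le_iff mult_1_right)
    moreover have "a + int l \<le> int k"
      using g(2) by (simp add: k_def)
    ultimately show "a + int l \<le> int (k * n)" by linarith
    show "block p a l = block x c l"
      using p(3) f(3) g(2) by (simp add: block_eq_iff add.commute)
  qed
qed

text \<open>Loops of the different states are repeated until they all have the same length, so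
  no aperiodicity is needed.\<close>

lemma uniform_period:
  assumes x: "x \<in> \<Sigma>"
  obtains L where "L \<ge> 1" "\<And>z. z \<in> link_class x \<Longrightarrow> \<exists>p a. p \<in> \<Sigma> \<and> periodic L p \<and>
    block p 0 m = block z 0 m \<and> a \<ge> 0 \<and> a + int l \<le> int L \<and> block p a l = block x c l"
proof -
  let ?B = "(\<lambda>z. block z 0 m) ` link_class x"
  let ?P = "\<lambda>b n. \<exists>p a. p \<in> \<Sigma> \<and> periodic n p \<and>
    block p 0 m = b \<and> a \<ge> 0 \<and> a + int l \<le> int n \<and> block p a l = block x c l"
  have fin: "finite ?B"
    by (rule finite_subset[OF _ finite_blocks[of m]]) (auto simp: link_class_def)
  have "\<forall>b\<in>?B. \<exists>n. ?P b n"
  proof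
    fix b assume "b \<in> ?B"
    then obtain z where z: "z \<in> \<Sigma>" "link z x" "b = block z 0 m"
      using link_sym by (auto simp: link_class_def)
    show "\<exists>n. ?P b n"
      using periodic_through[OF z(1) x z(2), of l c] z(3) by metis
  qed
  then obtain N where N: "\<And>b. b \<in> ?B \<Longrightarrow> ?P b (N b)"
    by metis
  define L where "L = prod N ?B"
  have "N b \<ge> 1" if "b \<in> ?B" for b
    using N[OF that] by (auto simp: periodic_def)
  then have L: "L \<ge> 1"
    unfolding L_def by (intro prod_ge_1) auto
  show ?thesis
  proof
    show "L \<ge> 1" by fact
    fix z assume "z \<in> link_class x"
    then have b: "block z 0 m \<in> ?B" by blast
    have dvd: "N (block z 0 m) dvd L"
      unfolding L_def using fin b by (rule dvd_prodI)
    then have "N (block z 0 m) \<le> L"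
      using L by (simp add: dvd_imp_le)
    then show "?P (block z 0 m) L"
      using N[OF b] periodic_dvd[OF _ dvd L] by fastforce
  qed
qed

text \<open>Leave \<open>z\<close> for \<open>p\<close> at position \<open>i\<close>. After
  \<open>L\<close> steps periodicity restores the state of \<open>z\<close> at \<open>i\<close>,
  where the rest of \<open>z\<close> can be resumed. The untouched left tail keeps the result in the
  same class.\<close>

lemma insert_loop:
  assumes x: "x \<in> \<Sigma>" and z: "z \<in> link_class x" and p: "p \<in> \<Sigma>" "periodic L p" "block p 0 m = block z i m"
    and a: "a \<ge> 0" "a + int l \<le> int L" "block p a l = u"
  obtains z' where "z' \<in> link_class x" "\<And>j. j < i \<Longrightarrow> z' j = z j" "\<And>j. j \<ge> i \<Longrightarrow> z' (j + int L) = z j"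
    "block z' (i + a) l = u"
proof -
  have zS: "z \<in> \<Sigma>" "link x z" using z by (auto simp: link_class_def)
  obtain h where h: "h \<in> \<Sigma>" "\<And>j. j < i + int m \<Longrightarrow> h j = z j" "\<And>j. i \<le> j \<Longrightarrow> h j = p (j + (0 - i))"
    using splice_block[OF zS(1) p(1), of i 0] p(3) by metis
  have per: "p (j + int L) = p j" for j
    using p(2) by (simp add: periodic_def)
  have "block h (i + int L) m = block p 0 m"
    using h(3) per by (simp add: block_eq_iff add.commute)
  then have "block h (i + int L) m = block z i m"
    using p(3) by simp
  then obtain f where f: "f \<in> \<Sigma>" "\<And>j. j < i + int L + int m \<Longrightarrow> f j = h j"
      "\<And>j. i + int L \<le> j \<Longrightarrow> f j = z (j + (i - (i + int L)))"
    using splice_block[OF h(1) zS(1), of "i + int L" i] by metis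
  show ?thesis
  proof
    show left: "f j = z j" if "j < i" for j
      using f(2) h(2) that by simp
    then have "block z (i - int m) m = block f (i - int m) m"
      by (simp add: block_eq_iff)
    then have "link z f"
      using link_blockI zS f(1) by blast
    then show "f \<in> link_class x"
      using zS f(1) link_trans by (auto simp: link_class_def)
    show "f (j + int L) = z j" if "j \<ge> i" for j
      using f(3)[of "j + int L"] that by simp
    show "block f (i + a) l = u"
      using f(2) h(3) a unfolding a(3)[symmetric] by (simp add: block_eq_iff)
  qed
qed

section \<open>Counting blocks\<close>

text \<open>Reading at position 0 loses no block, since a class is closed under translation.\<close>

definition blocks :: "(int \<Rightarrow> 'a) \<Rightarrow> nat \<Rightarrow> 'a list set" where
  "blocks x n = (\<lambda>z. block z 0 n) ` link_class x"

text \<open>Only occurrences inside the window of length \<open>n\<close> are forbidden; the point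
  may contain \<open>u\<close> elsewhere.\<close>

definition avoiding_blocks :: "(int \<Rightarrow> 'a) \<Rightarrow> 'a list \<Rightarrow> nat \<Rightarrow> 'a list set" where
  "avoiding_blocks x u n = (\<lambda>z. block z 0 n) `
     {z \<in> link_class x. \<forall>a. 0 \<le> a \<and> a + int (length u) \<le> int n \<longrightarrow> block z a (length u) \<noteq> u}"

lemma link_class_subset: "link_class x \<subseteq> \<Sigma>"
  by (auto simp: link_class_def)

lemma finite_blocks_class: "finite (blocks x n)"
  by (rule finite_subset[OF _ finite_blocks[of n]]) (auto simp: blocks_def link_class_def)

lemma finite_avoiding_blocks: "finite (avoiding_blocks x u n)"
  by (rule finite_subset[OF _ finite_blocks[of n]]) (auto simp: avoiding_blocks_def link_class_def)

text \<open>Cut each block after \<open>k\<close> letters; the remaining \<open>l\<close> letters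
  allow at most \<open>card A ^ l\<close> choices.\<close>

lemma card_blocks_add: "card (blocks x (k + l)) \<le> card (blocks x k) * card A ^ l"
proof -
  let ?V = "{xs. set xs \<subseteq> A \<and> length xs = l}"
  have "card (blocks x (k + l)) \<le> card (blocks x k \<times> ?V)"
  proof (rule card_inj_on_le)
    show "inj_on (\<lambda>w. (take k w, drop k w)) (blocks x (k + l))"
      by (rule inj_onI) (metis append_take_drop_id prod.inject)
    show "(\<lambda>w. (take k w, drop k w)) ` blocks x (k + l) \<subseteq> blocks x k \<times> ?V"
    proof
      fix v assume "v \<in> (\<lambda>w. (take k w, drop k w)) ` blocks x (k + l)"
      then obtain z where z: "z \<in> link_class x"
        "v = (take k (block z 0 (k + l)), drop k (block z 0 (k + l)))"
        by (auto simp: blocks_def)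
      then have "v = (block z 0 k, block z (int k) l)"
        by (simp add: block_add)
      moreover have "set (block z (int k) l) \<subseteq> A"
        using z(1) in_A link_class_subset by (intro set_block_subset) blast
      ultimately show "v \<in> blocks x k \<times> ?V"
        using z(1) by (simp add: blocks_def)
    qed
    show "finite (blocks x k \<times> ?V)"
      using finite_blocks_class finite_lists_length_eq[OF finite_A] by (intro finite_cartesian_product)
  qed
  then show ?thesis
    using card_lists_length_eq[OF finite_A] by (simp add: card_cartesian_product)
qed

text \<open>A loop through \<open>u\<close> inserted into a block avoiding \<open>u\<close> can be located in the result,
  so the insertion points multiply the number of blocks.\<close>

lemma card_avoiding_blocks_insert:
  assumes x: "x \<in> \<Sigma>" and u: "u = block x c l"
  obtains L where "L \<ge> 1"
    "\<And>q. q * card (avoiding_blocks x u (q * L)) \<le> card (blocks x (q * L + L))"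
proof -
  have len: "length u = l" using u by simp
  obtain L where L: "L \<ge> 1" "\<And>z. z \<in> link_class x \<Longrightarrow> \<exists>p a. p \<in> \<Sigma> \<and> periodic L p \<and>
    block p 0 m = block z 0 m \<and> a \<ge> 0 \<and> a + int l \<le> int L \<and> block p a l = u"
    using uniform_period[OF x, of l c] u by metis
  show ?thesis
  proof
    show "L \<ge> 1" by fact
    fix q
    let ?n = "q * L"
    let ?Z = "avoiding_blocks x u ?n"
    \<comment> \<open>\<open>z'\<close> shows \<open>w\<close> with a window of length
      \<open>L\<close> inserted at position \<open>s * L\<close>, and this window contains
      \<open>u\<close>. Insertion at multiples of \<open>L\<close> keeps the windows for different
      \<open>s\<close> disjoint.\<close>
    let ?good = "\<lambda>w s z'. z' \<in> link_class x \<and>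
      (\<forall>j. 0 \<le> j \<and> j < int (s * L) \<longrightarrow> z' j = w ! nat j) \<and>
      (\<forall>j. int (s * L) \<le> j \<and> j < int ?n \<longrightarrow> z' (j + int L) = w ! nat j) \<and>
      (\<exists>a. int (s * L) \<le> a \<and> a + int l \<le> int (s * L) + int L \<and> block z' a l = u)"
    have "\<exists>z'. ?good w s z'" if w: "w \<in> ?Z" and s: "s < q" for w s
    proof -
      have sL: "int (s * L) \<le> int ?n"
        using s by (intro of_nat_mono mult_right_mono) auto
      obtain z where z: "z \<in> link_class x" "w = block z 0 ?n"
        using w by (auto simp: avoiding_blocks_def)
      have nth: "w ! nat j = z j" if "0 \<le> j" "j < int ?n" for j
        using that z(2) by (simp add: nat_less_iff)
      let ?i = "int (s * L)"
      have zS: "z \<in> \<Sigma>" "link x z" using z(1) by (auto simp: link_class_def)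
      have "translate ?i z \<in> link_class x"
        using translate_in[OF zS(1)] link_trans[OF zS(2) link_translate[OF zS(1)]]
        by (simp add: link_class_def)
      then obtain p a where p: "p \<in> \<Sigma>" "periodic L p" "block p 0 m = block (translate ?i z) 0 m"
        and a: "a \<ge> 0" "a + int l \<le> int L" "block p a l = u"
        using L(2) by blast
      have "block p 0 m = block z ?i m"
        using p(3) by (simp add: block_translate)
      then obtain z' where z': "z' \<in> link_class x" "\<And>j. j < ?i \<Longrightarrow> z' j = z j"
          "\<And>j. j \<ge> ?i \<Longrightarrow> z' (j + int L) = z j" "block z' (?i + a) l = u"
        using insert_loop[OF x z(1) p(1,2) _ a] by metis
      have "z' j = w ! nat j" if "0 \<le> j" "j < ?i" for j
        using z'(2)[OF that(2)] nth[of j] that sL by simp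
      moreover have "z' (j + int L) = w ! nat j" if "?i \<le> j" "j < int ?n" for j
        using z'(3)[OF that(1)] nth[of j] that by simp
      moreover have "?i \<le> ?i + a \<and> ?i + a + int l \<le> ?i + int L \<and> block z' (?i + a) l = u"
        using z'(4) a by simp
      ultimately show ?thesis
        using z'(1) by blast
    qed
    then obtain G where G: "\<And>w s. w \<in> ?Z \<Longrightarrow> s < q \<Longrightarrow> ?good w s (G w s)"
      by metis
    have G_before: "G w s j = w ! nat j"
      if "w \<in> ?Z" "s < q" "0 \<le> j" "j < int (s * L)" for w s j
      using G[OF that(1,2)] that(3,4) by blast
    have G_after: "G w s (j + int L) = w ! nat j"
      if "w \<in> ?Z" "s < q" "int (s * L) \<le> j" "j < int ?n" for w s j
      using G[OF that(1,2)] that(3,4) by blast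
    \<comment> \<open>If \<open>s < s'\<close>, the copy of \<open>u\<close> inserted at
      \<open>s * L\<close> ends no later than \<open>s' * L\<close>. Up to there the second result
      still reads \<open>w'\<close>, which avoids \<open>u\<close>.\<close>
    have order: "\<not> s < s'"
      if w: "w \<in> ?Z" "w' \<in> ?Z" and s: "s < q" "s' < q"
        and eq: "block (G w s) 0 (?n + L) = block (G w' s') 0 (?n + L)" for w w' s s'
    proof
      assume less: "s < s'"
      obtain a where a: "int (s * L) \<le> a" "a + int l \<le> int (s * L) + int L" "block (G w s) a l = u"
        using G[OF w(1) s(1)] by blast
      have a0: "0 \<le> a" using a(1) by (rule order_trans[rotated]) simp
      have "Suc s * L \<le> s' * L" "s' * L \<le> q * L"
        using less s by (intro mult_le_mono1, simp)+
      then have "s * L + L \<le> s' * L" "s' * L \<le> ?n" by simp_all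
      then have le: "a + int l \<le> int (s' * L)" "int (s' * L) \<le> int ?n"
        using a(2) by linarith+
      obtain z where z: "w' = block z 0 ?n"
          "\<And>b. 0 \<le> b \<Longrightarrow> b + int l \<le> int ?n \<Longrightarrow> block z b l \<noteq> u"
        using w(2) len by (auto simp: avoiding_blocks_def)
      have "G w s j = z j" if j: "a \<le> j" "j < a + int l" for j
      proof -
        have jb: "0 \<le> j" "j < int (s' * L)" "j < int ?n" using j a0 le by linarith+
        then have "j < int (?n + L)" by simp
        then have "G w s j = G w' s' j"
          using eq jb(1) unfolding block_eq_iff by (metis add_0)
        also have "\<dots> = w' ! nat j"
          using G_before[OF w(2) s(2)] jb by blast
        also have "\<dots> = z j"
          using jb unfolding z(1) by (simp add: nat_less_iff)
        finally show ?thesis .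
      qed
      then have "block z a l = block (G w s) a l"
        by (simp add: block_eq_iff)
      then show False
        using z(2)[OF a0] le a(3) by simp
    qed
    have "card (?Z \<times> {..<q}) \<le> card (blocks x (?n + L))"
    proof (rule card_inj_on_le)
      show "inj_on (\<lambda>(w, s). block (G w s) 0 (?n + L)) (?Z \<times> {..<q})"
      proof (rule inj_onI)
        fix v v'
        assume v: "v \<in> ?Z \<times> {..<q}" "v' \<in> ?Z \<times> {..<q}"
          and v_eq: "(\<lambda>(w, s). block (G w s) 0 (?n + L)) v = (\<lambda>(w, s). block (G w s) 0 (?n + L)) v'"
        obtain w s where ws: "v = (w, s)" by (rule prod.exhaust)
        obtain w' s' where ws': "v' = (w', s')" by (rule prod.exhaust)
        have w: "w \<in> ?Z" "w' \<in> ?Z" and s: "s \<in> {..<q}" "s' \<in> {..<q}"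
          and eq: "block (G w s) 0 (?n + L) = block (G w' s') 0 (?n + L)"
          using v v_eq by (simp_all add: ws ws')
        have ss: "s = s'"
          using order[OF w _ _ eq] order[OF w(2,1) _ _ eq[symmetric]] s by force
        \<comment> \<open>With equal insertion points, deleting the inserted window recovers both
          words from the same block.\<close>
        have "w ! j = w' ! j" if j: "j < ?n" for j
        proof -
          have G_eq: "G w s i = G w' s' i" if "0 \<le> i" "i < int (?n + L)" for i
            using eq that unfolding block_eq_iff by (metis add_0)
          have sq: "s < q" "s' < q" using s by auto
          have jn: "int j < int (?n + L)" "int j + int L < int (?n + L)"
            unfolding of_nat_add[symmetric] of_nat_less_iff using j by simp_all
          show ?thesis
          proof (cases "int j < int (s * L)")
            case True
            have "G w s (int j) = w ! nat (int j)" "G w' s' (int j) = w' ! nat (int j)"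
              using G_before[OF w(1) sq(1) _ True] G_before[OF w(2) sq(2), of "int j"] True ss by auto
            moreover have "G w s (int j) = G w' s' (int j)"
              using jn by (intro G_eq) simp_all
            ultimately show ?thesis by simp
          next
            case False
            then have le: "int (s * L) \<le> int j" "int j < int ?n" using j by linarith+
            have "G w s (int j + int L) = w ! nat (int j)" "G w' s' (int j + int L) = w' ! nat (int j)"
              using G_after[OF w(1) sq(1) le] G_after[OF w(2) sq(2), of "int j"] le ss by auto
            moreover have "G w s (int j + int L) = G w' s' (int j + int L)"
              using jn by (intro G_eq) simp_all
            ultimately show ?thesis by simp
          qed
        qed
        moreover have "length w = ?n" "length w' = ?n"
          using w by (auto simp: avoiding_blocks_def)
        ultimately show "v = v'"
          using ss unfolding ws ws' by (auto intro: nth_equalityI)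
      qed
      show "(\<lambda>(w, s). block (G w s) 0 (?n + L)) ` (?Z \<times> {..<q}) \<subseteq> blocks x (?n + L)"
        using G by (fastforce simp: blocks_def)
    qed (rule finite_blocks_class)
    then show "q * card ?Z \<le> card (blocks x (?n + L))"
      by (simp add: card_cartesian_product mult.commute)
  qed
qed

section \<open>Exchanging the sides of a diamond, and the contradiction in the counts\<close>

lemma link_class_link: "z \<in> link_class x \<Longrightarrow> w \<in> \<Sigma> \<Longrightarrow> link z w \<Longrightarrow> w \<in> link_class x"
  using link_trans by (auto simp: link_class_def)

text \<open>The sides differ only within distance \<open>D\<close> of the centre. The window is wide
  enough that \<open>y\<close> can be spliced in at both ends, and that the image at any coordinate
  sees either only the replaced window or no change at all.\<close>

lemma exchange:
  fixes E :: nat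
  assumes T: "block_map r T" and x: "x \<in> \<Sigma>" and y: "y \<in> \<Sigma>" and Txy: "T x = T y"
    and D: "D \<ge> 0" "\<And>i. \<bar>i\<bar> \<ge> D \<Longrightarrow> x i = y i" "D + 2 * int r + int m < int E"
    and z: "z \<in> link_class x" "block z a (2 * E) = block x (- int E) (2 * E)"
  obtains z' where "z' \<in> link_class x" "block z' a (2 * E) = block y (- int E) (2 * E)"
    "\<And>i. i < a \<Longrightarrow> z' i = z i" "\<And>i. i \<ge> a + int (2 * E) \<Longrightarrow> z' i = z i" "T z' = T z"
proof -
  have zS: "z \<in> \<Sigma>" using z link_class_subset by blast
  have zx: "z i = x (i - a - int E)" if "a \<le> i" "i < a + 2 * int E" for i
    using z(2) that unfolding block_eq_iff_range by (simp add: algebra_simps)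
  have "block z a m = block y (- int E) m"
    using zx D unfolding block_eq_iff by simp
  then obtain g where g: "g \<in> \<Sigma>" "\<And>i. i < a + int m \<Longrightarrow> g i = z i" "\<And>i. a \<le> i \<Longrightarrow> g i = y (i + (- int E - a))"
    using splice_block[OF zS y, of a "- int E"] by metis
  \<comment> \<open>The last \<open>m\<close> coordinates of the window: \<open>x\<close> and
    \<open>y\<close> agree there, so the way back to \<open>z\<close> is open.\<close>
  let ?b = "a + 2 * int E - int m"
  have "block g ?b m = block z ?b m"
    unfolding block_eq_iff
  proof (intro allI impI)
    fix i assume i: "0 \<le> i \<and> i < int m"
    then have "g (?b + i) = y (?b + i - a - int E)"
      using g(3)[of "?b + i"] D(1,3) by (simp add: algebra_simps)
    also have "\<dots> = x (?b + i - a - int E)"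
      using i D(1,3) by (intro D(2)[symmetric]) simp
    also have "\<dots> = z (?b + i)"
      using i D(1,3) by (intro zx[symmetric]) simp_all
    finally show "g (?b + i) = z (?b + i)" .
  qed
  then obtain f where f: "f \<in> \<Sigma>" "\<And>i. i < ?b + int m \<Longrightarrow> f i = g i" "\<And>i. ?b \<le> i \<Longrightarrow> f i = z (i + (?b - ?b))"
    using splice_block[OF g(1) zS, of ?b ?b] by metis
  have left: "f i = z i" if "i < a" for i
    using f(2)[of i] g(2)[of i] that by simp
  have right: "f i = z i" if "i \<ge> a + 2 * int E" for i
    using f(3)[of i] that by simp
  have mid: "f i = y (i - a - int E)" if "a \<le> i" "i < a + 2 * int E" for i
    using f(2)[of i] g(3)[of i] that by (simp add: algebra_simps)
  have outer: "f i = z i" if "\<bar>i - a - int E\<bar> \<ge> D" for i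
  proof (cases "a \<le> i \<and> i < a + 2 * int E")
    case True
    then show ?thesis using mid[of i] zx[of i] D(2)[OF that] by simp
  next
    case False
    then show ?thesis using left[of i] right[of i] by linarith
  qed
  \<comment> \<open>Within \<open>D + r\<close> of the centre \<open>a + E\<close>, the rule reads
    only coordinates inside the window, because \<open>D + 2 * r < E\<close>, and
    \<open>T x = T y\<close> applies. Farther out it reads only coordinates where \<open>f\<close>
    and \<open>z\<close> agree.\<close>
  have "T f j = T z j" for j
  proof (cases "\<bar>j - a - int E\<bar> \<le> D + int r")
    case True
    have core: "a \<le> i" "i < a + 2 * int E" if "\<bar>i - j\<bar> \<le> int r" for i
      using True D(1,3) that by linarith+
    have "T f j = T y (j + (- a - int E))"
      by (rule block_map_local[OF T f(1) y]) (simp add: mid[OF core] algebra_simps)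
    also have "\<dots> = T x (j + (- a - int E))"
      using Txy by simp
    also have "\<dots> = T z j"
      by (rule block_map_local[OF T zS x, symmetric]) (simp add: zx[OF core] algebra_simps)
    finally show ?thesis .
  next
    case False
    then show ?thesis
      using block_map_local[OF T f(1) zS, of j 0] outer by simp
  qed
  then have Tfz: "T f = T z" ..
  have "block z (a - int m) m = block f (a - int m) m"
    using left by (simp add: block_eq_iff)
  then have "f \<in> link_class x"
    using link_class_link[OF z(1) f(1)] link_blockI[OF zS f(1)] by blast
  moreover have "block f a (2 * E) = block y (- int E) (2 * E)"
    unfolding block_eq_iff
  proof (intro allI impI)
    fix i assume "0 \<le> i \<and> i < int (2 * E)"
    then show "f (a + i) = y (- int E + i)"
      using mid[of "a + i"] by simp
  qed
  ultimately show ?thesis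
    using that[of f] left right Tfz by simp
qed

text \<open>Every image block has a lexicographically least preimage, and a least preimage avoids
  the larger side of a diamond.\<close>

lemma card_blocks_le_avoiding:
  fixes E :: nat
  assumes T: "block_map r T" and x: "x \<in> \<Sigma>" and y: "y \<in> \<Sigma>" and Txy: "T x = T y"
    and D: "D \<ge> 0" "\<And>i. \<bar>i\<bar> \<ge> D \<Longrightarrow> x i = y i" "D + 2 * int r + int m < int E"
    and R: "wf R" "(block y (- int E) (2 * E), block x (- int E) (2 * E)) \<in> lex R"
    and surj: "link_class x \<subseteq> T ` link_class x"
  shows "card (blocks x k) \<le> card (avoiding_blocks x (block x (- int E) (2 * E)) (k + 2 * r))"
proof -
  let ?u = "block x (- int E) (2 * E)"
  \<comment> \<open>An image block of length \<open>k\<close> at position \<open>r\<close> is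
    determined by these \<open>k + 2 * r\<close> coordinates, a margin of \<open>r\<close> on each
    side.\<close>
  let ?n = "k + 2 * r"
  \<comment> \<open>The image block of a word, computed from a chosen point of the class showing it;
    by locality the choice does not matter.\<close>
  let ?h = "\<lambda>w. block (T (SOME z. z \<in> link_class x \<and> block z 0 ?n = w)) (int r) k"
  have "blocks x k \<subseteq> ?h ` avoiding_blocks x ?u ?n"
  proof
    fix t assume "t \<in> blocks x k"
    then obtain t' where t': "t' \<in> link_class x" "t = block t' 0 k"
      by (auto simp: blocks_def)
    have tS: "t' \<in> \<Sigma>" using t' link_class_subset by blast
    then have "translate (- int r) t' \<in> link_class x"
      using link_class_link[OF t'(1)] translate_in link_translate by blast
    then obtain z0 where z0: "z0 \<in> link_class x" "translate (- int r) t' = T z0"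
      using surj by blast
    then have t0: "block (T z0) (int r) k = t"
      using t'(2) by (simp add: block_translate flip: z0(2))
    \<comment> \<open>All preimage words of \<open>t\<close>; the least of them cannot contain
      \<open>?u\<close>, since an exchange would produce a smaller one.\<close>
    define S where "S = {block z 0 ?n | z. z \<in> link_class x \<and> block (T z) (int r) k = t}"
    have "block z0 0 ?n \<in> S"
      unfolding S_def using z0(1) t0 by blast
    then obtain w where w: "w \<in> S"
      and least: "\<And>w'. (w', w) \<in> lex R \<Longrightarrow> w' \<notin> S"
      by (blast intro: wfE_min[OF wf_lex[OF R(1)]])
    obtain z where z: "z \<in> link_class x" "block (T z) (int r) k = t" "w = block z 0 ?n"
      using w unfolding S_def by blast
    have "block z a (2 * E) \<noteq> ?u" if a: "0 \<le> a" "a + int (2 * E) \<le> int ?n" for a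
    proof
      assume occ: "block z a (2 * E) = ?u"
      obtain z' where z': "z' \<in> link_class x" "block z' a (2 * E) = block y (- int E) (2 * E)"
        "\<And>i. i < a \<Longrightarrow> z' i = z i" "\<And>i. i \<ge> a + int (2 * E) \<Longrightarrow> z' i = z i" "T z' = T z"
        using exchange[OF T x y Txy D z(1) occ] by metis
      have "(block z' 0 ?n, w) \<in> lex R"
        unfolding z(3) by (rule lex_block_replace[OF R(2) occ z'(2) a z'(3,4)])
      then have "block z' 0 ?n \<notin> S"
        by (rule least)
      then show False
        using z'(1,5) z(2) unfolding S_def by auto
    qed
    then have "w \<in> avoiding_blocks x ?u ?n"
      using z(1,3) by (auto simp: avoiding_blocks_def)
    moreover have "t = ?h w"
    proof -
      let ?z = "SOME v. v \<in> link_class x \<and> block v 0 ?n = w"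
      have "?z \<in> link_class x \<and> block ?z 0 ?n = w"
        by (rule someI[of _ z]) (use z in auto)
      then have zz: "?z \<in> link_class x" "block ?z 0 ?n = w" by blast+
      have eq: "?z i = z i" if "0 \<le> i" "i < int ?n" for i
        using zz(2) that unfolding z(3) block_eq_iff by simp
      have "T ?z j = T z j" if "int r \<le> j" "j < int r + int k" for j
        using block_map_local[OF T, of ?z z j 0] eq zz(1) z(1) link_class_subset that by force
      then show ?thesis
        using z(2) by (simp add: block_eq_iff flip: z(2))
    qed
    ultimately show "t \<in> ?h ` avoiding_blocks x ?u ?n" by blast
  qed
  then show ?thesis
    by (rule surj_card_le[OF finite_avoiding_blocks])
qed

text \<open>Loop insertion multiplies the number of avoiding blocks by \<open>q\<close>, while least
  preimages and bounded growth allow only the constant factor \<open>c\<close>.\<close>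

lemma no_ordered_diamond:
  fixes E :: nat
  assumes T: "block_map r T" and x: "x \<in> \<Sigma>" and y: "y \<in> \<Sigma>" and Txy: "T x = T y"
    and D: "D \<ge> 0" "\<And>i. \<bar>i\<bar> \<ge> D \<Longrightarrow> x i = y i" "D + 2 * int r + int m < int E"
    and R: "wf R" "(block y (- int E) (2 * E), block x (- int E) (2 * E)) \<in> lex R"
    and surj: "link_class x \<subseteq> T ` link_class x"
  shows False
proof -
  let ?u = "block x (- int E) (2 * E)"
  obtain L where L: "L \<ge> 1"
      "\<And>q. q * card (avoiding_blocks x ?u (q * L)) \<le> card (blocks x (q * L + L))"
    using card_avoiding_blocks_insert[OF x refl] by metis
  define c where "c = card A ^ (2 * r + L)"
  \<comment> \<open>\<open>q\<close> must exceed \<open>c\<close>; the summand \<open>2 * r\<close>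
    makes \<open>q * L\<close> at least \<open>2 * r\<close>, so that it can be written as
    \<open>k + 2 * r\<close>.\<close>
  define q where "q = c + 1 + 2 * r"
  have "q * 1 \<le> q * L" using L(1) by (intro mult_left_mono) auto
  then have "2 * r \<le> q * L" by (simp add: q_def)
  then obtain k where k: "q * L = k + 2 * r"
    by (metis le_add_diff_inverse2)
  let ?Z = "card (avoiding_blocks x ?u (q * L))"
  have Z: "card (blocks x k) \<le> ?Z"
    using card_blocks_le_avoiding[OF T x y Txy D R surj, of k] by (simp add: k)
  have "q * ?Z \<le> card (blocks x (k + (2 * r + L)))"
    using L(2)[of q] by (simp add: k add.assoc)
  also have "\<dots> \<le> card (blocks x k) * c"
    unfolding c_def by (rule card_blocks_add)
  also have "\<dots> \<le> ?Z * c"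
    using Z by simp
  finally have "q * ?Z \<le> c * ?Z" by (simp add: mult.commute)
  moreover have "blocks x k \<noteq> {}"
    using x link_refl by (auto simp: blocks_def link_class_def)
  then have "card (blocks x k) > 0"
    using finite_blocks_class by (simp add: card_gt_0_iff)
  then have "?Z > 0" using Z by simp
  ultimately have "q \<le> c" by simp
  then show False by (simp add: q_def)
qed

text \<open>Different central blocks of equal length are comparable, and either of \<open>x\<close>
  and \<open>y\<close> can play the role of the larger side.\<close>

lemma no_diamond:
  assumes T: "block_map r T" and x: "x \<in> \<Sigma>" and y: "y \<in> \<Sigma>" and Txy: "T x = T y"
    and D: "\<And>i. \<bar>i\<bar> \<ge> D \<Longrightarrow> x i = y i"
    and surj: "link_class x \<subseteq> T ` link_class x"
  shows "x = y"
proof (rule ccontr)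
  assume "x \<noteq> y"
  then obtain i where i: "x i \<noteq> y i" by (auto simp: fun_eq_iff)
  then have iD: "\<bar>i\<bar> < D" using D by (meson not_less)
  define E where "E = nat (D + 2 * int r + int m + 1)"
  let ?u = "block x (- int E) (2 * E)" and ?v = "block y (- int E) (2 * E)"
  have E: "D \<ge> 0" "D + 2 * int r + int m < int E" "- int E \<le> i" "i < int E"
    using iD by (auto simp: E_def)
  have "?u \<noteq> ?v"
  proof
    assume "?u = ?v"
    then have "0 \<le> i + int E \<and> i + int E < int (2 * E) \<longrightarrow> x (- int E + (i + int E)) = y (- int E + (i + int E))"
      unfolding block_eq_iff by (rule spec)
    then show False using i E(3,4) by simp
  qed
  obtain R :: "'a rel" where R: "wf R" "total R" using wf_total_rel_exists by blast
  \<comment> \<open>Totality is available for \<open>lenlex\<close>, which on words of equal length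
    is \<open>lex\<close>.\<close>
  have "(?v, ?u) \<in> lenlex R \<or> (?u, ?v) \<in> lenlex R"
    using total_lenlex[OF R(2)] \<open>?u \<noteq> ?v\<close> unfolding total_on_def by blast
  then consider "(?v, ?u) \<in> lex R" | "(?u, ?v) \<in> lex R"
    by (auto simp: lenlex_conv)
  then show False
  proof cases
    case 1
    then show False
      using no_ordered_diamond[OF T x y Txy E(1) D E(2) R(1)] surj by blast
  next
    case 2
    \<comment> \<open>Agreement beyond \<open>D\<close> puts \<open>x\<close> and \<open>y\<close>
      in one class, so the surjectivity assumption carries over to \<open>y\<close>.\<close>
    have "block x D m = block y D m"
      using D E(1) by (simp add: block_eq_iff)
    then have "link_class x = link_class y"
      using link_class_eq_iff link_blockI x y by blast
    then show False
      using no_ordered_diamond[OF T y x Txy[symmetric] E(1) D[symmetric] E(2) R(1) 2] surj by simp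
  qed
qed

text \<open>Some iterate brings \<open>x\<close> back to its class. By cancellation every preimage
  of a point of that class under this iterate lies in the class again.\<close>

lemma block_map_funpow_image:
  assumes T: "block_map r T" and surj: "T ` \<Sigma> = \<Sigma>" and x: "x \<in> \<Sigma>"
  obtains p where "p \<ge> 1" "link_class x \<subseteq> (T ^^ p) ` link_class x"
proof -
  obtain p where p: "p \<ge> 1" "link ((T ^^ p) x) x"
    using link_funpow_recurrent[OF T surj x] by blast
  have pow: "(T ^^ k) ` \<Sigma> = \<Sigma>" for k
  proof (induction k)
    case (Suc k)
    have "(T ^^ Suc k) ` \<Sigma> = T ` ((T ^^ k) ` \<Sigma>)" by (simp add: image_image)
    then show ?case using Suc surj by simp
  qed simp
  have "link_class x \<subseteq> (T ^^ p) ` link_class x"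
  proof
    fix w assume w: "w \<in> link_class x"
    then have "w \<in> (T ^^ p) ` \<Sigma>" using pow link_class_subset by blast
    then obtain z where z: "z \<in> \<Sigma>" "w = (T ^^ p) z" by blast
    have "link ((T ^^ p) x) ((T ^^ p) z)"
      using w p(2) link_trans z(2) by (auto simp: link_class_def)
    then have "link x z"
      using link_funpow_cancel[OF T surj x z(1)] by blast
    then show "w \<in> (T ^^ p) ` link_class x"
      using z by (auto simp: link_class_def)
  qed
  then show ?thesis using that p(1) by blast
qed

end

section \<open>The topology of subshifts\<close>

text \<open>One period of \<open>w\<close> from \<open>c\<close> on is repeated forever. The assumed
  repetitions of \<open>w\<close> let the agreement propagate, one period at a time, up to
  \<open>d + n\<close>.\<close>

lemma periodic_extension:
  assumes "n \<ge> 1" and rep: "\<And>i. c \<le> i \<Longrightarrow> i \<le> d \<Longrightarrow> w (i + int n) = w i"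
  defines "p \<equiv> \<lambda>i. w (c + (i - c) mod int n)"
  shows "periodic n p" and "\<And>i. c \<le> i \<Longrightarrow> i \<le> d + int n \<Longrightarrow> p i = w i"
proof -
  have "(i + int n - c) mod int n = (i - c) mod int n" for i
    using mod_add_self2[of "i - c" "int n"] by (simp add: algebra_simps)
  then show per: "periodic n p"
    using \<open>n \<ge> 1\<close> by (simp add: periodic_def p_def)
  have eq: "p (c + int k) = w (c + int k)" if "c + int k \<le> d + int n" for k
    using that
  proof (induction k rule: less_induct)
    case (less k)
    show ?case
    proof (cases "k < n")
      case True
      then show ?thesis by (simp add: p_def)
    next
      case False
      then have k: "int (k - n) = int k - int n" by simp
      have "p (c + int k) = p (c + int (k - n))"
        using per by (simp add: periodic_def k) (metis diff_add_cancel add_diff_eq)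
      also have "\<dots> = w (c + int (k - n))"
        using less.IH[of "k - n"] less.prems False \<open>n \<ge> 1\<close> by simp
      also have "\<dots> = w (c + int k)"
        using rep[of "c + int (k - n)"] less.prems False by (simp add: k)
      finally show ?thesis .
    qed
  qed
  show "p i = w i" if "c \<le> i" "i \<le> d + int n" for i
    using eq[of "nat (i - c)"] that by simp
qed

lemma topspace_full_shift: "topspace (full_shift A) = {u. \<forall>i. u i \<in> A}"
  by (auto simp: full_shift_def PiE_def)

text \<open>Central cylinders form a neighborhood basis: a basic open set of the product restricts
  finitely many coordinates, and these lie in some interval around 0.\<close>

lemma openin_subshift_topology_iff:
  assumes "\<Sigma> \<subseteq> topspace (full_shift A)"
  shows "openin (subshift_topology A \<Sigma>) S \<longleftrightarrow>
    S \<subseteq> \<Sigma> \<and> (\<forall>x\<in>S. \<exists>N::nat. \<forall>v\<in>\<Sigma>. (\<forall>i. \<bar>i\<bar> \<le> int N \<longrightarrow> v i = x i) \<longrightarrow> v \<in> S)"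
proof (intro iffI conjI ballI)
  have in_A: "v i \<in> A" if "v \<in> \<Sigma>" for v i
    using assms that by (auto simp: topspace_full_shift)
  assume "openin (subshift_topology A \<Sigma>) S"
  then obtain T where T: "openin (full_shift A) T" "S = T \<inter> \<Sigma>"
    by (auto simp: openin_subtopology)
  then show "S \<subseteq> \<Sigma>" by blast
  fix x assume "x \<in> S"
  then have "x \<in> T" using T by blast
  then obtain U where U: "finite {i. U i \<noteq> A}" "x \<in> Pi\<^sub>E UNIV U" "Pi\<^sub>E UNIV U \<subseteq> T"
    using T(1) unfolding full_shift_def openin_product_topology_alt by auto
  define N where "N = Max (insert 0 ((\<lambda>i. nat \<bar>i\<bar>) ` {i. U i \<noteq> A}))"
  have N: "\<bar>i\<bar> \<le> int N" if "U i \<noteq> A" for i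
  proof -
    have "nat \<bar>i\<bar> \<le> N"
      unfolding N_def using U(1) that by (intro Max_ge) auto
    then show ?thesis by linarith
  qed
  show "\<exists>N::nat. \<forall>v\<in>\<Sigma>. (\<forall>i. \<bar>i\<bar> \<le> int N \<longrightarrow> v i = x i) \<longrightarrow> v \<in> S"
  proof (intro exI ballI impI)
    fix v assume v: "v \<in> \<Sigma>" "\<forall>i. \<bar>i\<bar> \<le> int N \<longrightarrow> v i = x i"
    have "v i \<in> U i" for i
    proof (cases "U i = A")
      case False
      then have "v i = x i" using N v(2) by blast
      then show ?thesis using U(2) by auto
    qed (use in_A v in blast)
    then have "v \<in> T" using U(3) by (auto simp: PiE_def)
    then show "v \<in> S" using T(2) v(1) by blast
  qed
next
  assume S: "S \<subseteq> \<Sigma> \<and> (\<forall>x\<in>S. \<exists>N::nat. \<forall>v\<in>\<Sigma>. (\<forall>i. \<bar>i\<bar> \<le> int N \<longrightarrow> v i = x i) \<longrightarrow> v \<in> S)"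
  show "openin (subshift_topology A \<Sigma>) S"
  proof (subst openin_subopen, intro ballI)
    fix x assume x: "x \<in> S"
    then obtain N :: nat where N: "\<And>v. v \<in> \<Sigma> \<Longrightarrow> \<forall>i. \<bar>i\<bar> \<le> int N \<longrightarrow> v i = x i \<Longrightarrow> v \<in> S"
      using S by blast
    define U where "U i = (if \<bar>i\<bar> \<le> int N then {x i} else A)" for i
    have xA: "x i \<in> A" for i
      using S x assms by (auto simp: topspace_full_shift)
    have "finite {i. U i \<noteq> A}"
      by (rule finite_subset[of _ "{- int N..int N}"]) (auto simp: U_def split: if_splits)
    then have "openin (full_shift A) (Pi\<^sub>E UNIV U)"
      using xA unfolding full_shift_def openin_PiE_gen by (auto simp: U_def)
    then have "openin (subshift_topology A \<Sigma>) (\<Sigma> \<inter> Pi\<^sub>E UNIV U)"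
      by (rule openin_subtopology_Int2)
    moreover have "x \<in> \<Sigma> \<inter> Pi\<^sub>E UNIV U"
      using x S xA by (auto simp: U_def)
    moreover have "\<Sigma> \<inter> Pi\<^sub>E UNIV U \<subseteq> S"
    proof
      fix v assume v: "v \<in> \<Sigma> \<inter> Pi\<^sub>E UNIV U"
      then have "v i \<in> U i" for i by auto
      then have "\<bar>i\<bar> \<le> int N \<longrightarrow> v i = x i" for i
        unfolding U_def by (metis singletonD)
      then show "v \<in> S" using N v by blast
    qed
    ultimately show "\<exists>T. openin (subshift_topology A \<Sigma>) T \<and> x \<in> T \<and> T \<subseteq> S" by blast
  qed
qed

lemma subshift_subset: "subshift A \<Sigma> \<Longrightarrow> \<Sigma> \<subseteq> topspace (full_shift A)"
  by (auto simp: subshift_def dest: closedin_subset)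

lemma compactin_subshift:
  assumes "finite A" "subshift A \<Sigma>"
  shows "compactin (full_shift A) \<Sigma>"
  using assms unfolding subshift_def full_shift_def
  by (intro closedin_compact_space) (simp_all add: compact_space_product_topology compact_space_discrete_topology)

lemma compact_space_subshift: "finite A \<Longrightarrow> subshift A \<Sigma> \<Longrightarrow> compact_space (subshift_topology A \<Sigma>)"
  using compactin_subshift compact_space_subtopology by blast

lemma topspace_subshift: "subshift A \<Sigma> \<Longrightarrow> topspace (subshift_topology A \<Sigma>) = \<Sigma>"
  using subshift_subset by (auto simp: topspace_subtopology)

lemma Hausdorff_space_subshift: "Hausdorff_space (subshift_topology A \<Sigma>)"
  unfolding full_shift_def
  by (intro Hausdorff_space_subtopology)
    (simp add: Hausdorff_space_product_topology Hausdorff_space_discrete_topology)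

section \<open>Splicing, periodic approximation and homoclinic points\<close>

lemma translate_subshift:
  assumes "shift ` \<Sigma> = \<Sigma>" "z \<in> \<Sigma>"
  shows "translate k z \<in> \<Sigma>"
proof -
  have "(shift ^^ n) ` \<Sigma> = \<Sigma>" for n
  proof (induction n)
    case (Suc n)
    have "(shift ^^ Suc n) ` \<Sigma> = shift ` ((shift ^^ n) ` \<Sigma>)" by (simp add: image_image)
    then show ?case using Suc assms(1) by simp
  qed simp
  then have img: "translate (- int n) ` \<Sigma> = \<Sigma>" for n
    by (simp add: shift_funpow)
  show ?thesis
  proof (cases "k \<le> 0")
    case True
    then show ?thesis using img[of "nat (- k)"] assms(2) by auto
  next
    case False
    then obtain w where "w \<in> \<Sigma>" "z = translate (- k) w"
      using img[of "nat k"] assms(2) by auto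
    then show ?thesis by simp
  qed
qed

text \<open>A window of length \<open>m + 1\<close> starting before \<open>a\<close> ends before
  \<open>a + m\<close> and reads only \<open>z\<close>; any other window reads only
  \<open>w\<close>.\<close>

lemma sft_splice:
  fixes m :: nat
  assumes \<Sigma>: "\<Sigma> = {u \<in> topspace (full_shift A). \<forall>n. block u n (m + 1) \<in> F}"
    and z: "z \<in> \<Sigma>" and w: "w \<in> \<Sigma>" and eq: "\<And>i. a \<le> i \<Longrightarrow> i < a + int m \<Longrightarrow> z i = w i"
  shows "(\<lambda>i. if i < a then z i else w i) \<in> \<Sigma>" (is "?g \<in> \<Sigma>")
proof -
  have "block ?g n (m + 1) \<in> F" for n
  proof (cases "n < a")
    case True
    then have "block ?g n (m + 1) = block z n (m + 1)"
      using eq by (auto simp: block_eq_iff)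
    then show ?thesis using z \<Sigma> by auto
  next
    case False
    then have "block ?g n (m + 1) = block w n (m + 1)"
      by (auto simp: block_eq_iff)
    then show ?thesis using w \<Sigma> by auto
  qed
  then show ?thesis
    using z w unfolding \<Sigma> topspace_full_shift by auto
qed

text \<open>A return of a cylinder around \<open>z\<close> yields a point \<open>w\<close> showing
  the central block of \<open>z\<close> twice, \<open>n\<close> apart. Its periodic continuation
  \<open>p\<close> has only windows that occur in \<open>w\<close>, so it satisfies the finite type
  condition.\<close>

lemma sft_periodic_approx:
  fixes m N :: nat
  assumes \<Sigma>: "\<Sigma> = {u \<in> topspace (full_shift A). \<forall>n. block u n (m + 1) \<in> F}"
    and nw: "non_wandering A \<Sigma>" and z: "z \<in> \<Sigma>"
  shows "\<exists>n p. p \<in> \<Sigma> \<and> periodic n p \<and> (\<forall>i. \<bar>i\<bar> \<le> int N \<longrightarrow> p i = z i)"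
proof -
  \<comment> \<open>\<open>N\<close> gives the closeness to \<open>z\<close>; the extra
    \<open>m\<close> keeps every window that starts in the first period within the range where
    \<open>p\<close> and \<open>w\<close> agree.\<close>
  define d where "d = int (N + m)"
  let ?U = "{v \<in> \<Sigma>. \<forall>i. \<bar>i\<bar> \<le> d \<longrightarrow> v i = z i}"
  have "openin (subshift_topology A \<Sigma>) ?U"
  proof (subst openin_subshift_topology_iff)
    show "\<Sigma> \<subseteq> topspace (full_shift A)"
      unfolding \<Sigma> by blast
    have "\<forall>v\<in>\<Sigma>. (\<forall>i. \<bar>i\<bar> \<le> d \<longrightarrow> v i = u i) \<longrightarrow> v \<in> ?U" if "u \<in> ?U" for u
      using that by simp
    then show "?U \<subseteq> \<Sigma> \<and> (\<forall>u\<in>?U. \<exists>M::nat. \<forall>v\<in>\<Sigma>. (\<forall>i. \<bar>i\<bar> \<le> int M \<longrightarrow> v i = u i) \<longrightarrow> v \<in> ?U)"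
      unfolding d_def by blast
  qed
  moreover have "z \<in> ?U" using z by simp
  ultimately obtain n :: nat where n: "n \<ge> 1" "?U \<inter> (shift ^^ n) ` ?U \<noteq> {}"
    using nw z unfolding non_wandering_def by (metis (no_types, lifting) mem_Collect_eq order_refl subsetI)
  then obtain v where v: "v \<in> ?U" "(shift ^^ n) v \<in> ?U" by blast
  define w where "w = translate (- int n) v"
  have w: "w \<in> ?U" using v(2) by (simp only: w_def shift_funpow)
  have w_z: "w i = z i" if "\<bar>i\<bar> \<le> d" for i using w that by blast
  have v_z: "w (i + int n) = z i" if "\<bar>i\<bar> \<le> d" for i
    using v(1) that by (simp add: w_def)
  have rep: "w (i + int n) = w i" if "- d \<le> i" "i \<le> d" for i
    using w_z[of i] v_z[of i] that by simp
  define p where "p = (\<lambda>i. w (- d + (i - - d) mod int n))"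
  have p: "periodic n p" "\<And>i. - d \<le> i \<Longrightarrow> i \<le> d + int n \<Longrightarrow> p i = w i"
    unfolding p_def using periodic_extension[where w = w, OF n(1) rep] by blast+
  have "block p k (m + 1) \<in> F" for k
  proof -
    define k' where "k' = - d + (k + d) mod int n"
    have k': "- d \<le> k'" "k' < - d + int n"
      using n(1) by (simp_all add: k'_def)
    have "k = k' + (k + d) div int n * int n"
      using div_mult_mod_eq[of "k + d" "int n"] by (simp add: k'_def algebra_simps)
    then have "p (k + i) = p (k' + i)" for i
      using periodic_mult[OF p(1), of "k' + i" "(k + d) div int n"] by (simp add: algebra_simps)
    then have "block p k (m + 1) = block p k' (m + 1)"
      by (simp add: block_eq_iff)
    also have "\<dots> = block w k' (m + 1)"
      unfolding block_eq_iff using k' by (auto intro!: p(2) simp: d_def)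
    finally show ?thesis using w \<Sigma> by auto
  qed
  moreover have "p i \<in> A" for i
    using w \<Sigma> by (auto simp: p_def topspace_full_shift)
  ultimately have "p \<in> \<Sigma>"
    unfolding \<Sigma> topspace_full_shift by blast
  moreover have "p i = z i" if "\<bar>i\<bar> \<le> int N" for i
    using p(2)[of i] w_z[of i] that by (simp add: d_def)
  ultimately show ?thesis using p(1) by blast
qed

lemma recurrent_sft_exists:
  assumes "finite A" "subshift_of_finite_type A \<Sigma>" "non_wandering A \<Sigma>"
  shows "\<exists>m. recurrent_sft A \<Sigma> m"
proof -
  obtain m F where \<Sigma>: "\<Sigma> = {u \<in> topspace (full_shift A). \<forall>n. block u n (m + 1) \<in> F}"
    using assms(2) unfolding subshift_of_finite_type_def block_def by blast
  have shift: "shift ` \<Sigma> = \<Sigma>"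
    using assms(2) by (simp add: subshift_of_finite_type_def subshift_def)
  have "\<Sigma> \<subseteq> topspace (full_shift A)"
    unfolding \<Sigma> by blast
  then have in_A: "z i \<in> A" if "z \<in> \<Sigma>" for z i
    using that by (auto simp: topspace_full_shift)
  have "recurrent_sft A \<Sigma> m"
  proof
    show "finite A" by fact
    show "z i \<in> A" if "z \<in> \<Sigma>" for z i
      using that by (rule in_A)
    show "translate k z \<in> \<Sigma>" if "z \<in> \<Sigma>" for z k
      using translate_subshift[OF shift that] .
    show "(\<lambda>i. if i < a then z i else w i) \<in> \<Sigma>"
      if "z \<in> \<Sigma>" "w \<in> \<Sigma>" "\<And>i. a \<le> i \<Longrightarrow> i < a + int m \<Longrightarrow> z i = w i" for z w a
      using \<Sigma> that by (rule sft_splice)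
    show "\<exists>n p. p \<in> \<Sigma> \<and> periodic n p \<and> (\<forall>i. \<bar>i\<bar> \<le> int N \<longrightarrow> p i = z i)" if "z \<in> \<Sigma>" for z N
      using \<Sigma> assms(3) that by (rule sft_periodic_approx)
  qed
  then show ?thesis ..
qed

text \<open>The sets of points with a given letter at 0 form an open cover of the compact \<Sigma>.
  Points closer than a Lebesgue number of it have the same letter at 0, whatever the compatible
  metric.\<close>

lemma homoclinic_finite_difference:
  assumes "finite A" "subshift A \<Sigma>" "homoclinic A \<Sigma> x y"
  obtains D where "\<And>i. \<bar>i\<bar> \<ge> D \<Longrightarrow> x i = y i"
proof -
  obtain d where d: "compatible_metric A \<Sigma> d"
    and lim: "((\<lambda>n::int. d (shift_pow n x) (shift_pow n y)) \<longlongrightarrow> 0) (filtercomap abs at_top)"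
    and xy: "x \<in> \<Sigma>" "y \<in> \<Sigma>"
    using assms(3) by (auto simp: homoclinic_def)
  interpret Metric_space \<Sigma> d
    using d by (simp add: compatible_metric_def)
  have top: "mtopology = subshift_topology A \<Sigma>"
    using d by (simp add: compatible_metric_def)
  have sub: "\<Sigma> \<subseteq> topspace (full_shift A)"
    using assms(2) by (rule subshift_subset)
  have tr: "translate k z \<in> \<Sigma>" if "z \<in> \<Sigma>" for k z
    using translate_subshift assms(2) that by (auto simp: subshift_def)
  let ?C = "(\<lambda>a. {z \<in> \<Sigma>. z 0 = a}) ` A"
  have comp: "compactin mtopology \<Sigma>"
    using compact_space_subshift[OF assms(1,2)] topspace_subshift[OF assms(2)]
    by (simp add: top compact_space_def)
  have cover: "\<Sigma> \<subseteq> \<Union> ?C"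
    using sub by (auto simp: topspace_full_shift)
  have op: "openin mtopology U" if "U \<in> ?C" for U
    using that unfolding top openin_subshift_topology_iff[OF sub] by force
  have "\<exists>e>0. \<forall>z\<in>\<Sigma>. \<exists>U\<in>?C. mball z e \<subseteq> U"
    by (rule lebesgue_number[OF comp cover op])
  then obtain e where e: "e > 0" "\<forall>z\<in>\<Sigma>. \<exists>U\<in>?C. mball z e \<subseteq> U"
    by (elim exE conjE)
  have near: "z 0 = w 0" if "z \<in> \<Sigma>" "w \<in> \<Sigma>" "d z w < e" for z w
  proof -
    obtain U where U: "U \<in> ?C" "mball z e \<subseteq> U"
      using bspec[OF e(2) \<open>z \<in> \<Sigma>\<close>] by (elim bexE)
    obtain a where a: "U = {z \<in> \<Sigma>. z 0 = a}"
      using U(1) by (elim imageE)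
    have "z \<in> mball z e" "w \<in> mball z e"
      using that e(1) by simp_all
    then have "z \<in> U" "w \<in> U" using U(2) by (simp_all only: subsetD)
    then show ?thesis unfolding a by simp
  qed
  have "eventually (\<lambda>n. d (shift_pow n x) (shift_pow n y) < e) (filtercomap abs at_top)"
    using lim e(1) by (rule order_tendstoD(2))
  then obtain D :: int where D: "\<And>n. \<bar>n\<bar> \<ge> D \<Longrightarrow> d (shift_pow n x) (shift_pow n y) < e"
    unfolding eventually_filtercomap eventually_at_top_linorder by blast
  \<comment> \<open>Coordinate \<open>i\<close> is brought to the origin by the power
    \<open>- i\<close> of the shift, hence the instance at \<open>- i\<close>.\<close>
  have "x i = y i" if "\<bar>i\<bar> \<ge> D" for i
    using near[OF tr[OF xy(1), of i] tr[OF xy(2), of i]] D[of "- i"] that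
    by (simp add: shift_pow_eq_translate)
  then show ?thesis by (rule that)
qed

section \<open>Endomorphisms as sliding block maps\<close>

lemma endomorphism_funpow:
  assumes "subshift A \<Sigma>" "endomorphism A \<Sigma> \<tau>"
  shows "endomorphism A \<Sigma> (\<tau> ^^ p)"
proof (induction p)
  case 0
  have "continuous_map (subshift_topology A \<Sigma>) (subshift_topology A \<Sigma>) id"
    by simp
  then show ?case by (simp add: endomorphism_def id_def)
next
  case (Suc p)
  have top: "topspace (subshift_topology A \<Sigma>) = \<Sigma>"
    using assms(1) by (rule topspace_subshift)
  have "(\<tau> ^^ p) u \<in> \<Sigma>" if "u \<in> \<Sigma>" for u
    using Suc continuous_map_image_subset_topspace that top
    unfolding endomorphism_def by blast
  then have "\<forall>u\<in>\<Sigma>. (\<tau> \<circ> \<tau> ^^ p) (shift u) = shift ((\<tau> \<circ> \<tau> ^^ p) u)"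
    using Suc assms(2) by (simp add: endomorphism_def)
  moreover have "continuous_map (subshift_topology A \<Sigma>) (subshift_topology A \<Sigma>) (\<tau> \<circ> \<tau> ^^ p)"
    using Suc assms(2) unfolding endomorphism_def by (blast intro: continuous_map_compose)
  ultimately show ?case
    unfolding endomorphism_def funpow.simps(2) by blast
qed

lemma shift_translate: "shift (translate (- int n) v) = translate (- int (Suc n)) v"
  by (simp add: shift_eq_translate del: translate_apply)

text \<open>Induction covers the powers of \<open>shift\<close>. For \<open>k > 0\<close>, apply
  this to \<open>translate k z\<close> and cancel the translation.\<close>

lemma endomorphism_translate:
  assumes \<Sigma>: "shift ` \<Sigma> = \<Sigma>" and com: "\<And>u. u \<in> \<Sigma> \<Longrightarrow> \<tau> (shift u) = shift (\<tau> u)" and z: "z \<in> \<Sigma>"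
  shows "\<tau> (translate k z) = translate k (\<tau> z)"
proof -
  have neg: "\<tau> (translate (- int n) u) = translate (- int n) (\<tau> u)" if "u \<in> \<Sigma>" for u n
  proof (induction n)
    case (Suc n)
    show ?case
      using Suc com[OF translate_subshift[OF \<Sigma> that], of "- int n"] by (simp only: shift_translate)
  qed simp
  show ?thesis
  proof (cases "k \<le> 0")
    case True
    then show ?thesis using neg[OF z, of "nat (- k)"] by simp
  next
    case False
    then have "\<tau> (translate (- k) (translate k z)) = translate (- k) (\<tau> (translate k z))"
      using neg[OF translate_subshift[OF \<Sigma> z], of "nat k" k] by simp
    then have "translate k (\<tau> z) = translate k (translate (- k) (\<tau> (translate k z)))"
      by simp
    then show ?thesis by simp
  qed
qed

text \<open>Continuity gives a radius \<open>N u\<close> at each point, and compactness reduces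
  these to finitely many, whose maximum serves for all.\<close>

lemma endomorphism_local:
  assumes "finite A" "subshift A \<Sigma>" "endomorphism A \<Sigma> \<tau>"
  obtains r :: nat where "\<And>u v. u \<in> \<Sigma> \<Longrightarrow> v \<in> \<Sigma> \<Longrightarrow> (\<forall>i. \<bar>i\<bar> \<le> int r \<longrightarrow> u i = v i) \<Longrightarrow> \<tau> u 0 = \<tau> v 0"
proof -
  let ?X = "subshift_topology A \<Sigma>"
  have sub: "\<Sigma> \<subseteq> topspace (full_shift A)"
    using assms(2) by (rule subshift_subset)
  have top: "topspace ?X = \<Sigma>"
    using assms(2) by (rule topspace_subshift)
  have cont: "continuous_map ?X ?X \<tau>"
    using assms(3) by (simp add: endomorphism_def)
  have "\<exists>N::nat. \<forall>v\<in>\<Sigma>. (\<forall>i. \<bar>i\<bar> \<le> int N \<longrightarrow> v i = u i) \<longrightarrow> \<tau> v 0 = \<tau> u 0" if u: "u \<in> \<Sigma>" for u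
  proof -
    have "openin ?X {v \<in> \<Sigma>. v 0 = \<tau> u 0}"
      unfolding openin_subshift_topology_iff[OF sub] by force
    then have "openin ?X {v \<in> topspace ?X. \<tau> v \<in> {v \<in> \<Sigma>. v 0 = \<tau> u 0}}"
      using cont openin_continuous_map_preimage by blast
    moreover have "u \<in> {v \<in> topspace ?X. \<tau> v \<in> {v \<in> \<Sigma>. v 0 = \<tau> u 0}}"
      using u cont top continuous_map_image_subset_topspace by fastforce
    ultimately show ?thesis
      unfolding openin_subshift_topology_iff[OF sub] by blast
  qed
  then obtain N :: "(int \<Rightarrow> 'a) \<Rightarrow> nat" where
    N: "\<And>u v. u \<in> \<Sigma> \<Longrightarrow> v \<in> \<Sigma> \<Longrightarrow> \<forall>i. \<bar>i\<bar> \<le> int (N u) \<longrightarrow> v i = u i \<Longrightarrow> \<tau> v 0 = \<tau> u 0"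
    by metis
  define V where "V u = {v \<in> \<Sigma>. \<forall>i. \<bar>i\<bar> \<le> int (N u) \<longrightarrow> v i = u i}" for u
  have "openin ?X (V u)" for u
    unfolding openin_subshift_topology_iff[OF sub] V_def by force
  moreover have "\<Sigma> \<subseteq> \<Union> (V ` \<Sigma>)"
    by (auto simp: V_def)
  ultimately obtain \<F> where \<F>: "finite \<F>" "\<F> \<subseteq> V ` \<Sigma>" "\<Sigma> \<subseteq> \<Union> \<F>"
    using compact_space_subshift[OF assms(1,2)] unfolding compact_space_alt top
    by (metis (no_types, lifting) image_iff)
  then obtain G where G: "finite G" "G \<subseteq> \<Sigma>" "\<F> = V ` G"
    using finite_subset_image by metis
  define r where "r = Max (insert 0 (N ` G))"
  show ?thesis
  proof
    fix u v assume u: "u \<in> \<Sigma>" and v: "v \<in> \<Sigma>" and uv: "\<forall>i. \<bar>i\<bar> \<le> int r \<longrightarrow> u i = v i"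
    obtain g where g: "g \<in> G" "u \<in> V g" using u \<F>(3) G(3) by blast
    then have "N g \<le> r" unfolding r_def using G(1) by (intro Max_ge) auto
    then have "v \<in> V g" using g(2) uv v by (auto simp: V_def)
    then have "\<tau> v 0 = \<tau> g 0" "\<tau> u 0 = \<tau> g 0"
      using N g G(2) by (auto simp: V_def)
    then show "\<tau> u 0 = \<tau> v 0" by simp
  qed
qed

section \<open>Surjunctivity and the Moore property\<close>

context recurrent_sft
begin

lemma endomorphism_block_map:
  assumes "subshift A \<Sigma>" "endomorphism A \<Sigma> \<tau>"
  obtains r where "block_map r \<tau>"
proof -
  obtain r :: nat where r: "\<And>u v. u \<in> \<Sigma> \<Longrightarrow> v \<in> \<Sigma> \<Longrightarrow> (\<forall>i. \<bar>i\<bar> \<le> int r \<longrightarrow> u i = v i) \<Longrightarrow> \<tau> u 0 = \<tau> v 0"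
    using endomorphism_local[OF finite_A assms] by metis
  have com: "\<tau> (translate k z) = translate k (\<tau> z)" if "z \<in> \<Sigma>" for k z
    using endomorphism_translate[of \<Sigma> \<tau> z k] assms that by (simp add: subshift_def endomorphism_def)
  have maps: "\<tau> z \<in> \<Sigma>" if "z \<in> \<Sigma>" for z
    using assms continuous_map_image_subset_topspace topspace_subshift that
    unfolding endomorphism_def by blast
  show ?thesis
    by (rule that[of r]) (use r com maps in \<open>unfold block_map_def, blast\<close>)
qed

text \<open>A point of period \<open>n\<close> is determined by \<open>n\<close> letters, so there
  are finitely many in \<Sigma>. \<open>T\<close> maps this finite set injectively into itself,
  hence onto.\<close>

lemma periodic_in_image:
  assumes T: "block_map r T" and inj: "inj_on T \<Sigma>" and p: "p \<in> \<Sigma>" "periodic n p"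
  shows "p \<in> T ` \<Sigma>"
proof -
  let ?P = "{q \<in> \<Sigma>. periodic n q}"
  have "inj_on (\<lambda>q. block q 0 n) ?P"
  proof (rule inj_onI)
    fix q q' assume q: "q \<in> ?P" "q' \<in> ?P" and eq: "block q 0 n = block q' 0 n"
    show "q = q'"
    proof
      fix i
      have "n \<ge> 1" using p(2) by (simp add: periodic_def)
      then have "q (i mod int n) = q' (i mod int n)"
        using eq by (simp add: block_eq_iff)
      then show "q i = q' i"
        using periodic_mod[of n q i] periodic_mod[of n q' i] q by simp
    qed
  qed
  moreover have "finite ((\<lambda>q. block q 0 n) ` ?P)"
    by (rule finite_subset[OF _ finite_blocks[of n]]) auto
  ultimately have fin: "finite ?P" by (rule finite_imageD[rotated])
  have "T ` ?P \<subseteq> ?P"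
  proof clarify
    fix q assume q: "q \<in> \<Sigma>" "periodic n q"
    have "translate (int n) q = q"
      using q(2) by (simp add: periodic_def fun_eq_iff)
    then have "translate (int n) (T q) = T q"
      using T q(1) unfolding block_map_def by metis
    then have "T q (i + int n) = T q i" for i
      by (metis translate_apply)
    then show "T q \<in> \<Sigma> \<and> periodic n (T q)"
      using q block_map_in[OF T] by (simp add: periodic_def)
  qed
  then have "T ` ?P = ?P"
    using endo_inj_surj[OF fin] inj_on_subset[OF inj, of ?P] by blast
  then show ?thesis using p by blast
qed

lemma surjunctive:
  assumes \<Sigma>: "subshift A \<Sigma>"
  shows "surjunctive A \<Sigma>"
  unfolding surjunctive_def
proof (intro allI impI, elim conjE)
  fix \<tau> assume \<tau>: "endomorphism A \<Sigma> \<tau>" and inj: "inj_on \<tau> \<Sigma>"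
  let ?X = "subshift_topology A \<Sigma>"
  obtain r where r: "block_map r \<tau>"
    using endomorphism_block_map[OF \<Sigma> \<tau>] .
  have top: "topspace ?X = \<Sigma>"
    using \<Sigma> by (rule topspace_subshift)
  have "compactin ?X \<Sigma>"
    using compact_space_subshift[OF finite_A \<Sigma>] unfolding compact_space_def top .
  then have "compactin ?X (\<tau> ` \<Sigma>)"
    using \<tau> image_compactin unfolding endomorphism_def by blast
  then have "closedin ?X (\<tau> ` \<Sigma>)"
    using Hausdorff_space_subshift compactin_imp_closedin by blast
  \<comment> \<open>If this open set were nonempty, it would contain a central cylinder, and with it
    a periodic point outside the image.\<close>
  then have op: "openin ?X (\<Sigma> - \<tau> ` \<Sigma>)"
    unfolding closedin_def top by blast
  have "\<Sigma> - \<tau> ` \<Sigma> = {}"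
  proof (rule ccontr)
    assume "\<Sigma> - \<tau> ` \<Sigma> \<noteq> {}"
    then obtain z where z: "z \<in> \<Sigma> - \<tau> ` \<Sigma>" by blast
    have "\<forall>x\<in>\<Sigma> - \<tau> ` \<Sigma>. \<exists>N::nat. \<forall>v\<in>\<Sigma>. (\<forall>i. \<bar>i\<bar> \<le> int N \<longrightarrow> v i = x i) \<longrightarrow> v \<in> \<Sigma> - \<tau> ` \<Sigma>"
      using op unfolding openin_subshift_topology_iff[OF subshift_subset[OF \<Sigma>]] by (rule conjunct2)
    from bspec[OF this z] obtain N :: nat
      where N: "\<forall>v\<in>\<Sigma>. (\<forall>i. \<bar>i\<bar> \<le> int N \<longrightarrow> v i = z i) \<longrightarrow> v \<in> \<Sigma> - \<tau> ` \<Sigma>" ..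
    have "z \<in> \<Sigma>" using z by (rule DiffD1)
    then obtain n p where p: "p \<in> \<Sigma>" "periodic n p" "\<forall>i. \<bar>i\<bar> \<le> int N \<longrightarrow> p i = z i"
      using approx[of z N] by blast
    have "p \<in> \<Sigma> - \<tau> ` \<Sigma>"
      using bspec[OF N p(1)] p(3) by (rule mp)
    then show False
      using periodic_in_image[OF r inj p(1,2)] by (rule DiffD2)
  qed
  moreover have "\<tau> ` \<Sigma> \<subseteq> \<Sigma>" using block_map_in[OF r] by blast
  ultimately show "\<tau> ` \<Sigma> = \<Sigma>" by blast
qed

lemma Moore_property:
  assumes \<Sigma>: "subshift A \<Sigma>"
  shows "Moore_property A \<Sigma>"
  unfolding Moore_property_def pre_injective_def
proof (intro allI impI ballI inj_onI, elim conjE)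
  fix \<tau> x y z
  assume \<tau>: "endomorphism A \<Sigma> \<tau>" and surj: "\<tau> ` \<Sigma> = \<Sigma>" and eq: "\<tau> y = \<tau> z"
    and "y \<in> {v. homoclinic A \<Sigma> x v}" "z \<in> {v. homoclinic A \<Sigma> x v}"
  then have y: "homoclinic A \<Sigma> x y" and z: "homoclinic A \<Sigma> x z" by blast+
  then have yz: "y \<in> \<Sigma>" "z \<in> \<Sigma>" by (auto simp: homoclinic_def)
  obtain D where D: "\<And>i. \<bar>i\<bar> \<ge> D \<Longrightarrow> x i = y i"
    using homoclinic_finite_difference[OF finite_A \<Sigma> y] by blast
  obtain D' where D': "\<And>i. \<bar>i\<bar> \<ge> D' \<Longrightarrow> x i = z i"
    using homoclinic_finite_difference[OF finite_A \<Sigma> z] by blast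
  \<comment> \<open>Two points homoclinic to \<open>x\<close> differ from each other in finitely
    many coordinates.\<close>
  have diff: "y i = z i" if "\<bar>i\<bar> \<ge> max D D'" for i
    using D[of i] D'[of i] that by simp
  obtain r where r: "block_map r \<tau>"
    using endomorphism_block_map[OF \<Sigma> \<tau>] .
  obtain p where p: "p \<ge> 1" "link_class y \<subseteq> (\<tau> ^^ p) ` link_class y"
    using block_map_funpow_image[OF r surj yz(1)] .
  obtain r' where r': "block_map r' (\<tau> ^^ p)"
    using endomorphism_block_map[OF \<Sigma> endomorphism_funpow[OF \<Sigma> \<tau>]] .
  \<comment> \<open>Here \<open>p \<ge> 1\<close> matters: the first application of \<tau> already
    identifies \<open>y\<close> and \<open>z\<close>.\<close>
  have "(\<tau> ^^ p) y = (\<tau> ^^ p) z"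
    using p(1) eq by (cases p) (simp_all add: funpow_swap1)
  then show "y = z"
    using no_diamond[OF r' yz _ diff p(2)] by blast
qed

end

theorem corollary1p4:
  fixes A :: "'a set" and \<Sigma> :: "(int \<Rightarrow> 'a) set"
  assumes "finite A"
    and "subshift_of_finite_type A \<Sigma>"
    and "non_wandering A \<Sigma>"
  shows "surjunctive A \<Sigma> \<and> Moore_property A \<Sigma>"
proof -
  obtain m where "recurrent_sft A \<Sigma> m"
    using recurrent_sft_exists[OF assms] ..
  then interpret recurrent_sft A \<Sigma> m .
  have "subshift A \<Sigma>"
    using assms(2) by (simp add: subshift_of_finite_type_def)
  then show ?thesis
    using surjunctive Moore_property by blast
qed

end
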